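(* Let $\Gamma$ be a group with finite symmetric generating set $S=S^{-1}$, let $\Delta=|S|\cdot\mathbf{1}-\sum_{s\in S}s\in\mathbb{R}[\Gamma]$, and let $T\in\mathcal{T}$. Then $$\inf\big\{\varepsilon\in\mathbb{R}\ \big|\ \exists\, x\in\mathcal{K}_T:\ \Phi(x)=\Delta^2+\varepsilon\Delta\big\}=-\inf_{x'\in\mathcal{F}'_T}x'(\Delta^2),$$ and both infima are assumed.
   Context: $\mathbf{1}$ denotes the neutral element of $\Gamma$. $\mathcal{T}$ denotes the collection of finite subsets $T\subset\Gamma$ that contain $\{\mathbf{1}\}\cup S$ and are connected in the Cayley graph of $(\Gamma,S)$, in which $\gamma$ and $\gamma s$ are neighbours for $s\in S$. For a subset $R\subset\Gamma$, $\mathrm{I}[R]=\{\sum_i\lambda_i\gamma_i\mid\gamma_i\in R,\ \lambda_i\in\mathbb{R},\ \sum_i\lambda_i=0\}\subset\mathbb{R}[\Gamma]$ (finite sums), and $T^{-1}T=\{t_1^{-1}t_2\mid t_1,t_2\in T\}$. The linear map $\Phi\colon\mathrm{I}[T]\otimes\mathrm{I}[T]\to\mathrm{I}[T^{-1}T]$ is the restriction of the linear map sending $\gamma_1\otimes\gamma_2$ to $\gamma_1^{-1}\gamma_2$. The convex cone $\mathcal{K}_T\subset\mathrm{I}[T]\otimes\mathrm{I}[T]$ is $\{\sum_i\omega_i\otimes\omega_i\mid\omega_i\in\mathrm{I}[T]\}$ (finite sums). $\mathcal{F}'_T$ is the set of linear functionals $x'\colon\mathrm{I}[T^{-1}T]\to\mathbb{R}$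 such that $x'(\Delta)=1$ and such that $\langle\cdot,\cdot\rangle_{x'}:=x'\circ\Phi$ is a (symmetric) positive semidefinite bilinear form on $\mathrm{I}[T]$.
   Formalization: That both infima are assumed is proved only for non-trivial Γ; for Γ={1}, Δ=0, every ε is admissible and F'_T is empty, so the infima are −∞ and +∞ and are not assumed (the equality still holds in the extended reals). *)

theory Defs
  imports "HOL-Algebra.Algebra" "HOL-Library.Poly_Mapping" "HOL-Library.Extended_Real"
begin

text \<open>The real group ring of \<open>G\<close> consists of the finitely supported functions \<open>'a \<Rightarrow>\<^sub>0 real\<close>
  whose support lies in \<open>carrier G\<close>; \<open>Poly_Mapping.single g 1\<close> is the group element \<open>g\<close>.\<close>

instantiation poly_mapping :: (type, real_vector) real_vector
begin

definition scaleR_poly_mapping :: "real \<Rightarrow> ('a \<Rightarrow>\<^sub>0 'b) \<Rightarrow> ('a \<Rightarrow>\<^sub>0 'b)" where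
  "scaleR_poly_mapping c x = Poly_Mapping.map ((*\<^sub>R) c) x"

lemma lookup_scaleR [simp]: "Poly_Mapping.lookup (c *\<^sub>R x) g = c *\<^sub>R Poly_Mapping.lookup x g"
  by (simp add: scaleR_poly_mapping_def Poly_Mapping.map.rep_eq when_def)

instance
  by standard
    (auto intro!: poly_mapping_eqI simp: lookup_add scaleR_add_right scaleR_add_left)

end

text \<open>The multiplication of \<open>Poly_Mapping\<close> needs the group to be a type of class
  \<open>monoid_add\<close>; the product below is the same convolution for the group \<open>G\<close>.\<close>

definition gr_mult :: "('a, 'b) monoid_scheme \<Rightarrow> ('a \<Rightarrow>\<^sub>0 real) \<Rightarrow> ('a \<Rightarrow>\<^sub>0 real) \<Rightarrow> ('a \<Rightarrow>\<^sub>0 real)" where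
  "gr_mult G x y = (\<Sum>g\<in>Poly_Mapping.keys x. \<Sum>h\<in>Poly_Mapping.keys y.
     Poly_Mapping.single (g \<otimes>\<^bsub>G\<^esub> h) (Poly_Mapping.lookup x g * Poly_Mapping.lookup y h))"

definition laplacian :: "('a, 'b) monoid_scheme \<Rightarrow> 'a set \<Rightarrow> ('a \<Rightarrow>\<^sub>0 real)" where
  "laplacian G S =
     real (card S) *\<^sub>R Poly_Mapping.single \<one>\<^bsub>G\<^esub> 1 - (\<Sum>s\<in>S. Poly_Mapping.single s 1)"

text \<open>Adjacency in the subgraph of the (right) Cayley graph of \<open>(G, S)\<close> induced on \<open>T\<close>. The
  relation is symmetric when \<open>S\<close> is closed under inverses.\<close>

definition cayley_adj :: "('a, 'b) monoid_scheme \<Rightarrow> 'a set \<Rightarrow> 'a set \<Rightarrow> ('a \<times> 'a) set" where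
  "cayley_adj G S T = {(g, h). g \<in> T \<and> h \<in> T \<and> (\<exists>s\<in>S. h = g \<otimes>\<^bsub>G\<^esub> s)}"

definition connected_supports :: "('a, 'b) monoid_scheme \<Rightarrow> 'a set \<Rightarrow> 'a set set" where
  "connected_supports G S =
     {T. T \<subseteq> carrier G \<and> finite T \<and> {\<one>\<^bsub>G\<^esub>} \<union> S \<subseteq> T \<and>
         (\<forall>g\<in>T. \<forall>h\<in>T. (g, h) \<in> (cayley_adj G S T)\<^sup>*)}"

definition aug :: "'a set \<Rightarrow> ('a \<Rightarrow>\<^sub>0 real) set" where
  "aug R = {x. Poly_Mapping.keys x \<subseteq> R \<and> (\<Sum>g\<in>Poly_Mapping.keys x. Poly_Mapping.lookup x g) = 0}"

text \<open>The tensor product of two group rings is realised as the finitely supported functions on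
  pairs of group elements, with \<open>g \<otimes> h\<close> the basis vector at \<open>(g, h)\<close>.\<close>

definition tensor :: "('a \<Rightarrow>\<^sub>0 real) \<Rightarrow> ('a \<Rightarrow>\<^sub>0 real) \<Rightarrow> ('a \<times> 'a \<Rightarrow>\<^sub>0 real)" where
  "tensor x y = (\<Sum>g\<in>Poly_Mapping.keys x. \<Sum>h\<in>Poly_Mapping.keys y. Poly_Mapping.single (g, h) (Poly_Mapping.lookup x g * Poly_Mapping.lookup y h))"

definition Phi :: "('a, 'b) monoid_scheme \<Rightarrow> ('a \<times> 'a \<Rightarrow>\<^sub>0 real) \<Rightarrow> ('a \<Rightarrow>\<^sub>0 real)" where
  "Phi G z = (\<Sum>(g, h)\<in>Poly_Mapping.keys z. Poly_Mapping.single (inv\<^bsub>G\<^esub> g \<otimes>\<^bsub>G\<^esub> h) (Poly_Mapping.lookup z (g, h)))"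

lemma lookup_tensor:
  "Poly_Mapping.lookup (tensor x y) (g, h) = Poly_Mapping.lookup x g * Poly_Mapping.lookup y h"
proof -
  have "Poly_Mapping.lookup (tensor x y) (g, h) =
      (\<Sum>a\<in>Poly_Mapping.keys x. \<Sum>b\<in>Poly_Mapping.keys y.
        if b = h then (if a = g then Poly_Mapping.lookup x a * Poly_Mapping.lookup y b else 0) else 0)"
    by (auto simp: tensor_def lookup_sum lookup_single when_def intro!: sum.cong)
  then show ?thesis
    by (cases "Poly_Mapping.lookup y h = 0") (simp_all add: in_keys_iff)
qed

lemma Phi_single:
  "Phi G (Poly_Mapping.single (g, h) 1) = Poly_Mapping.single (inv\<^bsub>G\<^esub> g \<otimes>\<^bsub>G\<^esub> h) 1"
  by (simp add: Phi_def)

lemma linear_Phi: "linear (Phi G)"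
proof -
  define e :: "'a \<times> 'a \<Rightarrow> real \<Rightarrow> 'a \<Rightarrow>\<^sub>0 real" where
    "e = (\<lambda>(g, h) c. Poly_Mapping.single (inv\<^bsub>G\<^esub> g \<otimes>\<^bsub>G\<^esub> h) c)"
  have e0: "e p 0 = 0" for p by (simp add: e_def split: prod.splits)
  have eadd: "e p (c + d) = e p c + e p d" for p c d
    by (simp add: e_def single_add split: prod.splits)
  have escale: "e p (r * c) = r *\<^sub>R e p c" for p r c
    by (auto simp: e_def lookup_single when_def split: prod.splits intro!: poly_mapping_eqI)
  have Phi_e: "Phi G z = (\<Sum>p\<in>A. e p (Poly_Mapping.lookup z p))"
    if "finite A" "Poly_Mapping.keys z \<subseteq> A" for z A
  proof -
    have "Phi G z = (\<Sum>p\<in>Poly_Mapping.keys z. e p (Poly_Mapping.lookup z p))"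
      by (auto simp: Phi_def e_def intro!: sum.cong)
    also have "\<dots> = (\<Sum>p\<in>A. e p (Poly_Mapping.lookup z p))"
      using that by (intro sum.mono_neutral_left) (auto simp: in_keys_iff e0)
    finally show ?thesis .
  qed
  show ?thesis
  proof (rule linearI)
    fix x y :: "'a \<times> 'a \<Rightarrow>\<^sub>0 real"
    let ?A = "Poly_Mapping.keys x \<union> Poly_Mapping.keys y"
    show "Phi G (x + y) = Phi G x + Phi G y"
      using Poly_Mapping.keys_add[of x y]
      by (simp add: Phi_e[of ?A] lookup_add eadd sum.distrib)
  next
    fix r :: real and x :: "'a \<times> 'a \<Rightarrow>\<^sub>0 real"
    have "Poly_Mapping.keys (r *\<^sub>R x) \<subseteq> Poly_Mapping.keys x"
      by (auto simp: in_keys_iff)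
    then show "Phi G (r *\<^sub>R x) = r *\<^sub>R Phi G x"
      by (simp add: Phi_e[of "Poly_Mapping.keys x"] escale scaleR_sum_right)
  qed
qed

definition sos_cone :: "'a set \<Rightarrow> ('a \<times> 'a \<Rightarrow>\<^sub>0 real) set" where
  "sos_cone T = {\<Sum>i<n. tensor (\<omega> i) (\<omega> i) | (n :: nat) \<omega>. \<forall>i<n. \<omega> i \<in> aug T}"

definition linear_functional_on :: "'v::real_vector set \<Rightarrow> ('v \<Rightarrow> real) \<Rightarrow> bool" where
  "linear_functional_on V f \<longleftrightarrow>
     (\<forall>x\<in>V. \<forall>y\<in>V. f (x + y) = f x + f y) \<and> (\<forall>c. \<forall>x\<in>V. f (c *\<^sub>R x) = c * f x)"

text \<open>A functional on the subspace \<open>aug (T\<^sup>-\<^sup>1 T)\<close> is represented by any function on the whole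
  group ring that is linear on that subspace; its values elsewhere are irrelevant.\<close>

definition dual_feasible ::
    "('a, 'b) monoid_scheme \<Rightarrow> 'a set \<Rightarrow> 'a set \<Rightarrow> (('a \<Rightarrow>\<^sub>0 real) \<Rightarrow> real) set" where
  "dual_feasible G S T =
     {x'. linear_functional_on (aug (set_inv\<^bsub>G\<^esub> T <#>\<^bsub>G\<^esub> T)) x' \<and>
          x' (laplacian G S) = 1 \<and>
          (\<forall>\<omega>\<in>aug T. \<forall>\<eta>\<in>aug T. x' (Phi G (tensor \<omega> \<eta>)) = x' (Phi G (tensor \<eta> \<omega>))) \<and>
          (\<forall>\<omega>\<in>aug T. 0 \<le> x' (Phi G (tensor \<omega> \<omega>)))}"

end

theory Submission
  imports Defs "HOL-Analysis.Function_Topology"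
begin

text \<open>
  Minimising \<open>\<epsilon>\<close> is a semidefinite program and \<open>-x'(\<Delta>\<^sup>2)\<close> is the objective of its dual. Weak duality
  is immediate: applying a feasible \<open>x'\<close> to \<open>\<Phi>(x) = \<Delta>\<^sup>2 + \<epsilon>\<Delta>\<close> gives \<open>0 \<le> x'(\<Delta>\<^sup>2) + \<epsilon>\<close>. That there
  is no gap, and that both optima exist, rests on two properties of the cone \<open>\<Phi>(K)\<close> of sums of
  squares.

  First, \<open>\<Delta>\<close> is an order unit (\<open>laplacian_order_unit\<close>). Indeed
  \<open>2\<Delta> = \<Sum>\<^sub>s (1 - s)\<^sup>*(1 - s)\<close> dominates the square of \<open>g - gs\<close> for every edge, since that square
  depends on \<open>s\<close> only, and the parallelogram law carries this along paths, so that connectedness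
  of \<open>T\<close> lets a multiple of \<open>\<Delta>\<close> dominate the square \<open>2 - k - k\<^sup>-\<^sup>1\<close> of \<open>g - h\<close>, where
  \<open>k = g\<^sup>-\<^sup>1h\<close>, for all \<open>g, h \<in> T\<close>. As \<open>1 - k\<close> is half of this square plus a skew-adjoint element,
  \<open>\<Delta>\<close> is an order unit of \<open>I[T\<^sup>-\<^sup>1T]\<close> for the cone \<open>\<Phi>(K) + skew\<close>; enlarging the cone by the
  skew-adjoint elements does not affect which self-adjoint elements lie in it, and it forces every
  functional that is nonnegative on it to be symmetric. The coefficient at the
  neutral element, which is the trace of the underlying matrix, shows that \<open>-\<Delta>\<close> is not in the cone
  if the group is not trivial. A Hahn-Banach argument for cones with an order unit
  (\<open>order_unit_support\<close>) then yields a normalised positive functional whose value at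
  \<open>\<Delta>\<^sup>2\<close> is minus the infimum over \<open>\<epsilon>\<close>: this is the dual optimum, with no gap.

  Second, slices of \<open>K\<close> of bounded trace are compact. Here \<open>K\<close> is viewed as the set of positive
  semidefinite matrices on \<open>T\<close> with entries summing to zero (\<open>sos_cone_iff_psd\<close>), which makes
  closedness evident. On matrices solving the primal equation \<open>\<epsilon>\<close> is an affine function of the
  trace, so it attains its minimum.

  For the trivial group \<open>\<Delta> = 0\<close>: every \<open>\<epsilon>\<close> is admissible, no \<open>x'\<close> is, and both sides are \<open>-\<infinity>\<close>.
\<close>

section \<open>Support functionals of cones with an order unit\<close>

definition sublinear_on :: "'v::real_vector set \<Rightarrow> ('v \<Rightarrow> real) \<Rightarrow> bool" where
  "sublinear_on V p \<longleftrightarrow>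
     (\<forall>x\<in>V. \<forall>y\<in>V. p (x + y) \<le> p x + p y) \<and> (\<forall>x\<in>V. \<forall>c\<ge>0. p (c *\<^sub>R x) = c * p x)"

lemma sublinear_on_add: "sublinear_on V p \<Longrightarrow> x \<in> V \<Longrightarrow> y \<in> V \<Longrightarrow> p (x + y) \<le> p x + p y"
  and sublinear_on_scale: "sublinear_on V p \<Longrightarrow> x \<in> V \<Longrightarrow> c \<ge> 0 \<Longrightarrow> p (c *\<^sub>R x) = c * p x"
  by (auto simp: sublinear_on_def)

lemma sublinear_on_neg:
  assumes "sublinear_on V p" "Real_Vector_Spaces.subspace V" "x \<in> V"
  shows "- p x \<le> p (- x)"
proof -
  have "- x \<in> V" using assms by (simp add: subspace_neg)
  then have "p (x + - x) \<le> p x + p (- x)" using assms sublinear_on_add by blast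
  moreover have "p 0 = 0" using sublinear_on_scale[OF assms(1,3), of 0] by simp
  ultimately show ?thesis by simp
qed

text \<open>One inequality gives positive homogeneity, since scaling by \<open>1 / c\<close> reverses it.\<close>

lemma sublinear_onI:
  assumes "Real_Vector_Spaces.subspace V" "p 0 = 0"
    and add: "\<And>x y. x \<in> V \<Longrightarrow> y \<in> V \<Longrightarrow> p (x + y) \<le> p x + p y"
    and scale: "\<And>c x. x \<in> V \<Longrightarrow> c > 0 \<Longrightarrow> p (c *\<^sub>R x) \<le> c * p x"
  shows "sublinear_on V p"
proof -
  have "p (c *\<^sub>R x) = c * p x" if "x \<in> V" "c > 0" for c x
  proof -
    have "c *\<^sub>R x \<in> V" using that assms(1) by (simp add: subspace_scale)
    from scale[OF this, of "1 / c"] that have "p x \<le> (1 / c) * p (c *\<^sub>R x)" by simp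
    then have "c * p x \<le> p (c *\<^sub>R x)" using that by (simp add: field_simps)
    then show ?thesis using scale[OF that] by simp
  qed
  then have "p (c *\<^sub>R x) = c * p x" if "x \<in> V" "c \<ge> 0" for c x
    using that assms(2) by (cases "c = 0") auto
  then show ?thesis using add by (simp add: sublinear_on_def)
qed

text \<open>
  One step of Hahn-Banach. The functional \<open>q x = inf {p (x + t v) - t p v | t \<ge> 0}\<close> is the largest
  sublinear minorant of \<open>p\<close> that is linear on the line through \<open>v\<close> and agrees with \<open>p\<close> at \<open>v\<close>.
\<close>

lemma sublinear_flatten:
  assumes V: "Real_Vector_Spaces.subspace V" and p: "sublinear_on V p" and v: "v \<in> V"
  shows "\<exists>q. sublinear_on V q \<and> (\<forall>x\<in>V. q x \<le> p x) \<and> q (- v) = - p v"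
proof -
  define A where "A x = {p (x + t *\<^sub>R v) - t * p v | t. t \<ge> 0}" for x
  define q where "q x = Inf (A x)" for x
  have V': "x + t *\<^sub>R v \<in> V" "t *\<^sub>R v \<in> V" if "x \<in> V" for x t
    using that V v by (simp_all add: subspace_add subspace_scale)
  have lb: "- p (- x) \<le> p (x + t *\<^sub>R v) - t * p v" if "x \<in> V" "t \<ge> 0" for x t
  proof -
    have "p ((x + t *\<^sub>R v) + - x) \<le> p (x + t *\<^sub>R v) + p (- x)"
      using that V V' by (intro sublinear_on_add[OF p]) (auto simp: subspace_neg)
    then show ?thesis using sublinear_on_scale[OF p v that(2)] by simp
  qed
  have q_le: "q x \<le> p (x + t *\<^sub>R v) - t * p v" if "x \<in> V" "t \<ge> 0" for x t
    unfolding q_def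
  proof (rule cInf_lower)
    show "bdd_below (A x)" using lb that by (auto simp: A_def bdd_below_def)
  qed (use that in \<open>auto simp: A_def\<close>)
  have q_ge: "m \<le> q x" if "\<And>t. t \<ge> 0 \<Longrightarrow> m \<le> p (x + t *\<^sub>R v) - t * p v" for x m
    unfolding q_def
  proof (rule cInf_greatest)
    show "A x \<noteq> {}" by (auto simp: A_def intro: exI[of _ 0])
  qed (use that in \<open>auto simp: A_def\<close>)
  have le: "q x \<le> p x" if "x \<in> V" for x using q_le[OF that, of 0] by simp
  have p0: "p 0 = 0" using sublinear_on_scale[OF p v, of 0] by simp
  have "sublinear_on V q"
  proof (rule sublinear_onI[OF V])
    have "q 0 \<le> 0" using le[of 0] p0 V by (simp add: subspace_0)
    moreover have "0 \<le> q 0" using sublinear_on_scale[OF p v] by (intro q_ge) simp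
    ultimately show "q 0 = 0" by simp
  next
    fix x y assume xy: "x \<in> V" "y \<in> V"
    have "q (x + y) \<le> (p (x + s *\<^sub>R v) - s * p v) + (p (y + t *\<^sub>R v) - t * p v)"
      if "s \<ge> 0" "t \<ge> 0" for s t
    proof -
      have "q (x + y) \<le> p ((x + y) + (s + t) *\<^sub>R v) - (s + t) * p v"
        using xy that V by (intro q_le) (auto simp: subspace_add)
      also have "(x + y) + (s + t) *\<^sub>R v = (x + s *\<^sub>R v) + (y + t *\<^sub>R v)"
        by (simp add: algebra_simps)
      finally show ?thesis
        using sublinear_on_add[OF p V'(1)[OF xy(1), of s] V'(1)[OF xy(2), of t]]
        by (simp add: algebra_simps)
    qed
    then have "q (x + y) - (p (x + s *\<^sub>R v) - s * p v) \<le> q y" if "s \<ge> 0" for s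
      using that by (intro q_ge) force
    then have "q (x + y) - q y \<le> q x" by (intro q_ge) force
    then show "q (x + y) \<le> q x + q y" by simp
  next
    fix c :: real and x assume x: "x \<in> V" and c: "c > 0"
    have "q (c *\<^sub>R x) / c \<le> q x"
    proof (rule q_ge)
      fix t :: real assume t: "t \<ge> 0"
      have "q (c *\<^sub>R x) \<le> p (c *\<^sub>R x + (c * t) *\<^sub>R v) - (c * t) * p v"
        using x c t V by (intro q_le) (auto simp: subspace_scale)
      also have "c *\<^sub>R x + (c * t) *\<^sub>R v = c *\<^sub>R (x + t *\<^sub>R v)" by (simp add: algebra_simps)
      also have "p \<dots> = c * p (x + t *\<^sub>R v)" using sublinear_on_scale[OF p V'(1)[OF x]] c by simp
      finally show "q (c *\<^sub>R x) / c \<le> p (x + t *\<^sub>R v) - t * p v"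
        using c by (simp add: field_simps)
    qed
    then show "q (c *\<^sub>R x) \<le> c * q x" using c by (simp add: field_simps)
  qed
  moreover have "q (- v) = - p v"
  proof (rule antisym)
    show "q (- v) \<le> - p v" using q_le[of "- v" 1] p0 v V by (simp add: subspace_neg)
    show "- p v \<le> q (- v)" using lb[of "- v"] v V by (intro q_ge) (simp add: subspace_neg)
  qed
  ultimately show ?thesis using le by blast
qed

text \<open>
  Flattening in one direction after another does not undo earlier steps: if \<open>q\<close> is odd at \<open>b\<close> and
  \<open>r \<le> q\<close> is sublinear, then \<open>-r b \<le> r (-b) \<le> q (-b) = -q b \<le> -r b\<close>.
\<close>

lemma sublinear_flatten_finite:
  assumes "finite B" "Real_Vector_Spaces.subspace V" "B \<subseteq> V" "sublinear_on V p"
  shows "\<exists>q. sublinear_on V q \<and> (\<forall>x\<in>V. q x \<le> p x) \<and> (\<forall>b\<in>B. q (- b) = - q b)"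
  using assms(1,3)
proof (induction B)
  case empty
  then show ?case using assms(4) by auto
next
  case (insert b B)
  then obtain q where q: "sublinear_on V q" "\<forall>x\<in>V. q x \<le> p x" "\<forall>b\<in>B. q (- b) = - q b"
    by auto
  obtain r where r: "sublinear_on V r" "\<forall>x\<in>V. r x \<le> q x" "r (- b) = - q b"
    using sublinear_flatten[OF assms(2) q(1)] insert.prems by blast
  have "r (- b') = - r b'" if "b' \<in> insert b B" for b'
  proof -
    have b': "b' \<in> V" "- b' \<in> V" using that insert.prems assms(2) by (auto simp: subspace_neg)
    have "r (- b') \<le> - q b'" using that q(3) r(2,3) b' by force
    moreover have "r b' \<le> q b'" using r(2) b' by auto
    moreover have "- r b' \<le> r (- b')" using sublinear_on_neg[OF r(1) assms(2) b'(1)] .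
    ultimately show ?thesis by simp
  qed
  then show ?case using r q by (meson order_trans)
qed

lemma sublinear_odd_imp_linear:
  assumes q: "sublinear_on (span B) q" and odd: "\<And>b. b \<in> B \<Longrightarrow> q (- b) = - q b"
  shows "linear_functional_on (span B) q"
proof -
  let ?V = "span B"
  have add: "q (x + y) = q x + q y \<and> q (- (x + y)) = - q (x + y)"
    if "x \<in> ?V" "y \<in> ?V" "q (- x) = - q x" "q (- y) = - q y" for x y
  proof -
    have "q (- x + - y) \<le> q (- x) + q (- y)"
      using that by (intro sublinear_on_add[OF q]) (auto simp: span_neg)
    moreover have "q (x + y) \<le> q x + q y" using that by (intro sublinear_on_add[OF q])
    moreover have "- q (x + y) \<le> q (- (x + y))"
      using that by (intro sublinear_on_neg[OF q]) (auto simp: span_add)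
    ultimately show ?thesis using that by simp
  qed
  have scale: "q (c *\<^sub>R x) = c * q x" if "x \<in> ?V" "q (- x) = - q x" for c x
  proof (cases "c \<ge> 0")
    case False
    then have "q (c *\<^sub>R x) = q ((- c) *\<^sub>R (- x))" by simp
    also have "\<dots> = (- c) * q (- x)"
      using False that by (intro sublinear_on_scale[OF q]) (auto simp: span_neg)
    finally show ?thesis using that by simp
  qed (use sublinear_on_scale[OF q] that in auto)
  have "x \<in> ?V \<and> q (- x) = - q x" if "x \<in> ?V" for x
    using that
  proof (induction rule: span_induct_alt)
    case base
    show ?case using sublinear_on_scale[OF q span_zero, of 0] by (simp add: span_zero)
  next
    case (step c b y)
    have b: "b \<in> ?V" using step by (simp add: span_base)
    have cb: "c *\<^sub>R b \<in> ?V" using b by (simp add: span_scale)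
    have "q (- (c *\<^sub>R b)) = - q (c *\<^sub>R b)"
      using scale[OF b odd[OF step(1)], of c] scale[OF b odd[OF step(1)], of "- c"] by simp
    then show ?case using add[of "c *\<^sub>R b" y] step.IH cb by (simp add: span_add)
  qed
  then have neg: "q (- x) = - q x" if "x \<in> ?V" for x using that by blast
  show ?thesis
    unfolding linear_functional_on_def
  proof (intro conjI ballI allI)
    show "q (x + y) = q x + q y" if "x \<in> ?V" "y \<in> ?V" for x y using add that neg by simp
    show "q (c *\<^sub>R x) = c * q x" if "x \<in> ?V" for c x using scale that neg by simp
  qed
qed

text \<open>
  The gauge \<open>p x = inf {t. t e - x \<in> C}\<close> is finite because \<open>e\<close> is an order unit, bounded below
  because \<open>-e \<notin> C\<close>, and sublinear. A linear \<open>f \<le> p\<close> is nonnegative on \<open>C\<close> and satisfies \<open>f e = 1\<close>.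
  Flattening \<open>p\<close> at \<open>-v0\<close> before the generators makes \<open>f\<close> agree with \<open>p\<close> there, and \<open>p (-v0)\<close> is
  the infimum in the conclusion.
\<close>

lemma order_unit_support:
  fixes C :: "'v::real_vector set"
  assumes B: "finite B" and e: "e \<in> span B" and v0: "v0 \<in> span B"
    and C0: "0 \<in> C" and Cadd: "\<And>x y. x \<in> C \<Longrightarrow> y \<in> C \<Longrightarrow> x + y \<in> C"
    and Cscale: "\<And>c x. x \<in> C \<Longrightarrow> c \<ge> 0 \<Longrightarrow> c *\<^sub>R x \<in> C"
    and neg: "- e \<notin> C"
    and unit: "\<And>b. b \<in> B \<Longrightarrow> \<exists>t. t *\<^sub>R e + b \<in> C" "\<And>b. b \<in> B \<Longrightarrow> \<exists>t. t *\<^sub>R e - b \<in> C"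
  shows "(\<exists>t. v0 + t *\<^sub>R e \<in> C) \<and>
    (\<exists>f. linear_functional_on (span B) f \<and> f e = 1 \<and> (\<forall>x\<in>C \<inter> span B. 0 \<le> f x) \<and>
         f v0 = - Inf {t. v0 + t *\<^sub>R e \<in> C})"
proof -
  let ?V = "span B"
  have V: "Real_Vector_Spaces.subspace ?V" by (rule subspace_span)
  have dom: "(\<exists>t. t *\<^sub>R e + x \<in> C) \<and> (\<exists>t. t *\<^sub>R e - x \<in> C)" if "x \<in> ?V" for x
    using that
  proof (induction rule: span_induct_alt)
    case base
    show ?case using C0 by (auto intro: exI[of _ 0])
  next
    case (step c b y)
    obtain s1 s2 where s: "s1 *\<^sub>R e + y \<in> C" "s2 *\<^sub>R e - y \<in> C" using step by blast
    obtain t1 t2 where t: "t1 *\<^sub>R e + b \<in> C" "t2 *\<^sub>R e - b \<in> C" using unit step by blast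
    have "\<exists>u1 u2. u1 *\<^sub>R e + c *\<^sub>R b \<in> C \<and> u2 *\<^sub>R e - c *\<^sub>R b \<in> C"
    proof (cases "c \<ge> 0")
      case True
      have "(c * t1) *\<^sub>R e + c *\<^sub>R b \<in> C" "(c * t2) *\<^sub>R e - c *\<^sub>R b \<in> C"
        using Cscale[OF t(1) True] Cscale[OF t(2) True] by (simp_all add: algebra_simps)
      then show ?thesis by blast
    next
      case False
      then have "- c \<ge> 0" by simp
      from Cscale[OF t(2) this] Cscale[OF t(1) this]
      have "(- c * t2) *\<^sub>R e + c *\<^sub>R b \<in> C" "(- c * t1) *\<^sub>R e - c *\<^sub>R b \<in> C"
        by (simp_all add: scaleR_add_right scaleR_diff_right)
      then show ?thesis by blast
    qed
    then obtain u1 u2 where u: "u1 *\<^sub>R e + c *\<^sub>R b \<in> C" "u2 *\<^sub>R e - c *\<^sub>R b \<in> C" by blast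
    have "(u1 + s1) *\<^sub>R e + (c *\<^sub>R b + y) \<in> C" "(u2 + s2) *\<^sub>R e - (c *\<^sub>R b + y) \<in> C"
      using Cadd[OF u(1) s(1)] Cadd[OF u(2) s(2)] by (simp_all add: algebra_simps)
    then show ?case by blast
  qed
  have nonneg: "t \<ge> 0" if "t *\<^sub>R e \<in> C" for t
  proof (rule ccontr)
    assume "\<not> t \<ge> 0"
    then show False using Cscale[OF that, of "- (1 / t)"] neg by simp
  qed
  define A where "A x = {t. t *\<^sub>R e - x \<in> C}" for x
  define p where "p x = Inf (A x)" for x
  have p_le: "p x \<le> t" if x: "x \<in> ?V" and t: "t *\<^sub>R e - x \<in> C" for x t
    unfolding p_def
  proof (rule cInf_lower)
    obtain s where s: "s *\<^sub>R e + x \<in> C" using dom[OF x] by blast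
    have "- s \<le> u" if "u \<in> A x" for u
      using nonneg[of "s + u"] Cadd[OF s, of "u *\<^sub>R e - x"] that
      by (simp add: A_def algebra_simps)
    then show "bdd_below (A x)" by (auto simp: bdd_below_def)
  qed (use t in \<open>simp add: A_def\<close>)
  have p_ge: "m \<le> p x" if x: "x \<in> ?V" and m: "\<And>t. t *\<^sub>R e - x \<in> C \<Longrightarrow> m \<le> t" for x m
    unfolding p_def
  proof (rule cInf_greatest)
    show "A x \<noteq> {}" using dom[OF x] by (auto simp: A_def)
  qed (use m in \<open>simp add: A_def\<close>)
  have p: "sublinear_on ?V p"
  proof (rule sublinear_onI[OF V])
    show "p 0 = 0"
      using p_le[of 0 0] p_ge[of 0 0] C0 nonneg by (force simp: span_zero)
  next
    fix x y assume xy: "x \<in> ?V" "y \<in> ?V"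
    have "p (x + y) \<le> s + t" if "s *\<^sub>R e - x \<in> C" "t *\<^sub>R e - y \<in> C" for s t
      using Cadd[OF that] xy by (intro p_le) (auto simp: span_add algebra_simps)
    then have "p (x + y) - s \<le> p y" if "s *\<^sub>R e - x \<in> C" for s
      using that xy by (intro p_ge) force+
    then have "p (x + y) - p y \<le> p x" using xy by (intro p_ge) force+
    then show "p (x + y) \<le> p x + p y" by simp
  next
    fix c :: real and x assume x: "x \<in> ?V" and c: "c > 0"
    have "p (c *\<^sub>R x) / c \<le> p x"
    proof (rule p_ge[OF x])
      fix t assume "t *\<^sub>R e - x \<in> C"
      from Cscale[OF this, of c] c have "(c * t) *\<^sub>R e - c *\<^sub>R x \<in> C" by (simp add: algebra_simps)
      then have "p (c *\<^sub>R x) \<le> c * t" using x by (intro p_le) (auto simp: span_scale)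
      then show "p (c *\<^sub>R x) / c \<le> t" using c by (simp add: field_simps)
    qed
    then show "p (c *\<^sub>R x) \<le> c * p x" using c by (simp add: field_simps)
  qed
  obtain q where q: "sublinear_on ?V q" "\<forall>x\<in>?V. q x \<le> p x" "q (- (- v0)) = - p (- v0)"
    using sublinear_flatten[OF V p, of "- v0"] v0 by (auto simp: span_neg)
  obtain f where f: "sublinear_on ?V f" "\<forall>x\<in>?V. f x \<le> q x" "\<forall>b\<in>B. f (- b) = - f b"
    using sublinear_flatten_finite[OF B V _ q(1)] by (auto simp: span_superset)
  have lin: "linear_functional_on ?V f" using sublinear_odd_imp_linear f by blast
  have fneg: "f (- x) = - f x" if "x \<in> ?V" for x
    using lin that unfolding linear_functional_on_def
    by (metis mult_minus_left mult_1 scaleR_minus1_left)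
  have fp: "f x \<le> p x" if "x \<in> ?V" for x using f(2) q(2) that by force
  have "f e = 1"
    using fp[of e] fp[of "- e"] p_le[of e 1] p_le[of "- e" "-1"] e C0 fneg[of e]
    by (simp add: span_neg)
  moreover have "0 \<le> f x" if "x \<in> C \<inter> ?V" for x
    using fp[of "- x"] p_le[of "- x" 0] fneg[of x] that by (simp add: span_neg)
  moreover have "f v0 = - Inf {t. v0 + t *\<^sub>R e \<in> C}"
  proof -
    have "f v0 \<le> - p (- v0)" using f(2) q(3) v0 by auto
    moreover have "- f v0 \<le> p (- v0)" using fp[of "- v0"] fneg[of v0] v0 by (simp add: span_neg)
    ultimately show ?thesis by (simp add: p_def A_def add.commute)
  qed
  moreover have "\<exists>t. v0 + t *\<^sub>R e \<in> C" using dom[OF v0] by (simp add: add.commute)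
  ultimately show ?thesis using lin by blast
qed

section \<open>Sums of squares as positive semidefinite matrices\<close>

text \<open>
  Cholesky factorisation: split off the square of the (scaled) row of \<open>a\<close> and continue with the
  Schur complement. If the pivot \<open>M a a\<close> vanishes then so does its row, and with the convention
  \<open>x / 0 = 0\<close> the same formulas apply.
\<close>

lemma psd_imp_sum_of_squares:
  fixes M :: "'a \<Rightarrow> 'a \<Rightarrow> real"
  assumes "finite T" and "\<And>g h. g \<in> T \<Longrightarrow> h \<in> T \<Longrightarrow> M g h = M h g"
    and "\<And>c. 0 \<le> (\<Sum>g\<in>T. \<Sum>h\<in>T. c g * c h * M g h)"
  shows "\<exists>(n::nat) w. \<forall>g\<in>T. \<forall>h\<in>T. M g h = (\<Sum>i<n. w i g * w i h)"
  using assms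
proof (induction T arbitrary: M)
  case empty
  then show ?case by simp
next
  case (insert a T)
  have split: "(\<Sum>g\<in>insert a T. \<Sum>h\<in>insert a T. c g * c h * M g h) =
      c a * c a * M a a + 2 * c a * (\<Sum>h\<in>T. c h * M a h) + (\<Sum>g\<in>T. \<Sum>h\<in>T. c g * c h * M g h)"
    for c
  proof -
    have "(\<Sum>g\<in>T. c g * c a * M g a) = c a * (\<Sum>h\<in>T. c h * M a h)"
      using insert.prems(1) by (auto simp: sum_distrib_left algebra_simps intro!: sum.cong)
    moreover have "(\<Sum>h\<in>T. c a * c h * M a h) = c a * (\<Sum>h\<in>T. c h * M a h)"
      by (auto simp: sum_distrib_left algebra_simps intro!: sum.cong)
    ultimately show ?thesis using insert.hyps by (simp add: sum.distrib)
  qed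
  have aa: "M a a \<ge> 0"
  proof -
    have "(\<Sum>g\<in>T. \<Sum>h\<in>T. (if g = a then 1 else 0) * (if h = a then 1 else 0) * M g h) = 0"
      using insert.hyps by (intro sum.neutral) auto
    moreover have "(\<Sum>h\<in>T. (if h = a then 1 else 0) * M a h) = 0"
      using insert.hyps by (intro sum.neutral) auto
    ultimately show ?thesis
      using insert.prems(2)[of "\<lambda>x. if x = a then 1 else 0"] unfolding split by simp
  qed
  define r where "r = sqrt (M a a)"
  have rr: "r * r = M a a" using aa by (simp add: r_def)
  define u where "u g = M a g / r" for g
  have row: "M a h = u a * u h" if h: "h \<in> insert a T" for h
  proof (cases "M a a = 0")
    case False
    then have "r \<noteq> 0" using rr by auto
    then have "u a = r" by (simp add: u_def flip: rr)
    then show ?thesis using \<open>r \<noteq> 0\<close> by (simp add: u_def)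
  next
    case True
    have "M a h = 0" if "h \<noteq> a"
    proof (rule ccontr)
      assume nz: "M a h \<noteq> 0"
      \<comment> \<open>The coefficients \<open>y\<close> at \<open>a\<close> and \<open>1\<close> at \<open>h\<close> give the form the value \<open>-1\<close>.\<close>
      define y where "y = - (M h h + 1) / (2 * M a h)"
      define c where "c = (\<lambda>x. if x = a then y else if x = h then 1 else 0)"
      have hT: "h \<in> T" using h that by simp
      have ca: "c a = y" by (simp add: c_def)
      have cT: "c g = (if g = h then 1 else 0)" if "g \<in> T" for g
        using that insert.hyps by (auto simp: c_def)
      have 1: "(\<Sum>g\<in>T. c g * M a g) = M a h"
        using hT insert.hyps by (simp add: cT if_distrib[of "\<lambda>x. x * _"] cong: if_cong)
      have "(\<Sum>g\<in>T. \<Sum>k\<in>T. c g * c k * M g k) = (\<Sum>g\<in>T. if g = h then (\<Sum>k\<in>T. if k = h then M g k else 0) else 0)"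
        by (intro sum.cong) (auto simp: cT intro!: sum.cong sum.neutral)
      also have "\<dots> = M h h" using hT insert.hyps by simp
      finally have "0 \<le> 2 * y * M a h + M h h"
        using insert.prems(2)[of c] unfolding split by (simp add: 1 ca True)
      then show False using nz by (simp add: y_def field_simps)
    qed
    then show ?thesis using True by (cases "h = a") (auto simp: u_def r_def)
  qed
  \<comment> \<open>The Schur complement: its form is that of \<open>M\<close> minimised over the coefficient at \<open>a\<close>.\<close>
  define M' where "M' g h = M g h - u g * u h" for g h
  have "\<exists>(n::nat) w. \<forall>g\<in>T. \<forall>h\<in>T. M' g h = (\<Sum>i<n. w i g * w i h)"
  proof (rule insert.IH)
    show "M' g h = M' h g" if "g \<in> T" "h \<in> T" for g h
      using that insert.prems(1) by (simp add: M'_def)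
    fix c :: "'a \<Rightarrow> real"
    let ?B = "\<Sum>h\<in>T. c h * M a h"
    let ?Q = "\<Sum>g\<in>T. \<Sum>h\<in>T. c g * c h * M g h"
    define c' where "c' = c(a := - ?B / M a a)"
    have c'T: "c' g = c g" if "g \<in> T" for g using that insert.hyps by (auto simp: c'_def)
    have "0 \<le> c' a * c' a * M a a + 2 * c' a * ?B + ?Q"
      using insert.prems(2)[of c'] unfolding split by (simp add: c'T)
    also have "\<dots> = ?Q - (?B / r) * (?B / r)"
      using rr by (cases "M a a = 0") (auto simp: c'_def field_simps)
    also have "\<dots> = (\<Sum>g\<in>T. \<Sum>h\<in>T. c g * c h * M' g h)"
    proof -
      have "?B / r = (\<Sum>h\<in>T. c h * u h)" by (simp add: u_def sum_divide_distrib)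
      then show ?thesis
        by (simp add: M'_def sum_product right_diff_distrib sum_subtractf algebra_simps)
    qed
    finally show "0 \<le> (\<Sum>g\<in>T. \<Sum>h\<in>T. c g * c h * M' g h)" .
  qed
  then obtain n :: nat and w where
    w: "\<And>g h. g \<in> T \<Longrightarrow> h \<in> T \<Longrightarrow> M' g h = (\<Sum>i<n. w i g * w i h)" by blast
  define w' where "w' i = (if i < n then (w i)(a := 0) else u)" for i
  have "M g h = (\<Sum>i<Suc n. w' i g * w' i h)" if gh: "g \<in> insert a T" "h \<in> insert a T" for g h
  proof -
    have *: "(\<Sum>i<Suc n. w' i g * w' i h) = (\<Sum>i<n. ((w i)(a := 0)) g * ((w i)(a := 0)) h) + u g * u h"
      by (simp add: w'_def)
    consider "g = a" | "h = a" | "g \<noteq> a" "h \<noteq> a" by blast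
    then show ?thesis
    proof cases
      case 1 then show ?thesis using row[OF gh(2)] unfolding * by simp
    next
      case 2
      then have "M g h = M a g" using insert.prems(1) gh by blast
      then show ?thesis using 2 row[OF gh(1)] unfolding * by simp
    next
      case 3
      then have "M' g h = (\<Sum>i<n. w i g * w i h)" using w gh by blast
      then show ?thesis using 3 unfolding * M'_def by simp
    qed
  qed
  then show ?case by blast
qed

text \<open>
  Matrices indexed by \<open>T\<close> are encoded as functions vanishing off \<open>T \<times> T\<close>, so that the product
  topology of the function type applies to them.
\<close>

definition psd_matrices :: "'a set \<Rightarrow> ('a \<times> 'a \<Rightarrow> real) set" where
  "psd_matrices T = {m. (\<forall>p. p \<notin> T \<times> T \<longrightarrow> m p = 0) \<and> (\<forall>g h. m (g, h) = m (h, g)) \<and>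
     (\<Sum>g\<in>T. \<Sum>h\<in>T. m (g, h)) = 0 \<and> (\<forall>c. 0 \<le> (\<Sum>g\<in>T. \<Sum>h\<in>T. c g * c h * m (g, h)))}"

lemma aug_iff:
  assumes "finite T"
  shows "x \<in> aug T \<longleftrightarrow> Poly_Mapping.keys x \<subseteq> T \<and> (\<Sum>g\<in>T. Poly_Mapping.lookup x g) = 0"
proof -
  have "(\<Sum>g\<in>Poly_Mapping.keys x. Poly_Mapping.lookup x g) = (\<Sum>g\<in>T. Poly_Mapping.lookup x g)"
    if "Poly_Mapping.keys x \<subseteq> T"
    using that assms by (intro sum.mono_neutral_left) (auto simp: in_keys_iff)
  then show ?thesis by (auto simp: aug_def)
qed

lemma sum_squares_form:
  fixes w :: "nat \<Rightarrow> 'a \<Rightarrow> real"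
  shows "(\<Sum>g\<in>T. \<Sum>h\<in>T. c g * c h * (\<Sum>i<n. w i g * w i h)) = (\<Sum>i<n. (\<Sum>g\<in>T. c g * w i g)\<^sup>2)"
proof -
  have "(\<Sum>g\<in>T. \<Sum>h\<in>T. c g * c h * (\<Sum>i<n. w i g * w i h)) =
      (\<Sum>g\<in>T. \<Sum>h\<in>T. \<Sum>i<n. (c g * w i g) * (c h * w i h))"
    by (simp add: sum_distrib_left algebra_simps)
  also have "\<dots> = (\<Sum>g\<in>T. \<Sum>i<n. \<Sum>h\<in>T. (c g * w i g) * (c h * w i h))"
    by (intro sum.cong refl sum.swap)
  also have "\<dots> = (\<Sum>i<n. \<Sum>g\<in>T. \<Sum>h\<in>T. (c g * w i g) * (c h * w i h))"
    by (rule sum.swap)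
  finally show ?thesis by (simp add: power2_eq_square sum_product)
qed

text \<open>
  A sum of squares \<open>\<Sum>\<^sub>i \<omega>\<^sub>i \<otimes> \<omega>\<^sub>i\<close> is a Gram matrix. The condition on each \<open>\<omega>\<^sub>i\<close> to have augmentation zero
  becomes a single linear condition on the matrix, since the sum of all entries is the sum of
  the squared augmentations. In this form the cone is visibly closed under sums, nonnegative
  multiples and limits.
\<close>

lemma sos_cone_iff_psd:
  assumes T: "finite T"
  shows "x \<in> sos_cone T \<longleftrightarrow> Poly_Mapping.lookup x \<in> psd_matrices T"
proof
  assume "x \<in> sos_cone T"
  then obtain n :: nat and w where x: "x = (\<Sum>i<n. tensor (w i) (w i))"
    and w: "\<And>i. i < n \<Longrightarrow> w i \<in> aug T" by (auto simp: sos_cone_def)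
  let ?w = "\<lambda>i. Poly_Mapping.lookup (w i)"
  have m: "Poly_Mapping.lookup x (g, h) = (\<Sum>i<n. ?w i g * ?w i h)" for g h
    by (simp add: x lookup_sum lookup_tensor)
  have off: "?w i g = 0" if "i < n" "g \<notin> T" for i g
    using w[OF that(1)] that(2) by (auto simp: aug_def in_keys_iff)
  have form: "(\<Sum>g\<in>T. \<Sum>h\<in>T. c g * c h * Poly_Mapping.lookup x (g, h)) =
      (\<Sum>i<n. (\<Sum>g\<in>T. c g * ?w i g)\<^sup>2)" for c
    unfolding m by (rule sum_squares_form)
  have "(\<Sum>g\<in>T. \<Sum>h\<in>T. Poly_Mapping.lookup x (g, h)) = 0"
    using form[of "\<lambda>_. 1"] w T by (simp add: aug_iff)
  moreover have "Poly_Mapping.lookup x p = 0" if "p \<notin> T \<times> T" for p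
    using that off by (cases p) (auto simp: m intro!: sum.neutral)
  ultimately show "Poly_Mapping.lookup x \<in> psd_matrices T"
    by (auto simp: psd_matrices_def form[unfolded m] m mult.commute intro: sum_nonneg)
next
  assume psd: "Poly_Mapping.lookup x \<in> psd_matrices T"
  let ?M = "\<lambda>g h. Poly_Mapping.lookup x (g, h)"
  obtain n :: nat and w where w: "\<And>g h. g \<in> T \<Longrightarrow> h \<in> T \<Longrightarrow> ?M g h = (\<Sum>i<n. w i g * w i h)"
    using psd_imp_sum_of_squares[OF T, of ?M] psd by (auto simp: psd_matrices_def)
  define W where "W i = Abs_poly_mapping (\<lambda>g. if g \<in> T then w i g else 0)" for i
  have W: "Poly_Mapping.lookup (W i) g = (if g \<in> T then w i g else 0)" for i g
    unfolding W_def using T by (subst lookup_Abs_poly_mapping) (auto intro: finite_subset)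
  \<comment> \<open>All entries of the matrix sum to the sum of the squared augmentations.\<close>
  have "(\<Sum>i<n. (\<Sum>g\<in>T. w i g)\<^sup>2) = (\<Sum>g\<in>T. \<Sum>h\<in>T. ?M g h)"
    using sum_squares_form[where c = "\<lambda>_. 1" and w = w and n = n and T = T] w by simp
  also have "\<dots> = 0" using psd by (simp add: psd_matrices_def)
  finally have "\<forall>i<n. (\<Sum>g\<in>T. w i g) = 0" by (simp add: sum_nonneg_eq_0_iff)
  moreover have "Poly_Mapping.keys (W i) \<subseteq> T" for i by (auto simp: W in_keys_iff split: if_splits)
  ultimately have "W i \<in> aug T" if "i < n" for i using that by (simp add: aug_iff[OF T] W)
  moreover have "x = (\<Sum>i<n. tensor (W i) (W i))"
  proof (rule poly_mapping_eqI)
    fix p :: "'a \<times> 'a"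
    obtain g h where p: "p = (g, h)" by fastforce
    have "?M g h = 0" if "\<not> (g \<in> T \<and> h \<in> T)" using psd that by (simp add: psd_matrices_def)
    then have "?M g h = (\<Sum>i<n. Poly_Mapping.lookup (W i) g * Poly_Mapping.lookup (W i) h)"
      by (cases "g \<in> T \<and> h \<in> T") (auto simp: w W intro!: sum.neutral)
    then show "Poly_Mapping.lookup x p = Poly_Mapping.lookup (\<Sum>i<n. tensor (W i) (W i)) p"
      by (simp add: p lookup_sum lookup_tensor)
  qed
  ultimately show "x \<in> sos_cone T" unfolding sos_cone_def by blast
qed

lemma sos_cone_zero: "0 \<in> sos_cone T"
  unfolding sos_cone_def by (auto intro: exI[of _ 0])

lemma sos_cone_square: "\<omega> \<in> aug T \<Longrightarrow> tensor \<omega> \<omega> \<in> sos_cone T"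
  unfolding sos_cone_def by (auto intro!: exI[of _ 1] exI[of _ "\<lambda>_. \<omega>"])

lemma sos_cone_add:
  assumes "finite T" "x \<in> sos_cone T" "y \<in> sos_cone T"
  shows "x + y \<in> sos_cone T"
  using assms(2,3) unfolding sos_cone_iff_psd[OF assms(1)] psd_matrices_def
  by (auto simp: lookup_add sum.distrib algebra_simps intro!: add_nonneg_nonneg)

lemma sos_cone_scale:
  assumes "finite T" "x \<in> sos_cone T" "c \<ge> 0"
  shows "c *\<^sub>R x \<in> sos_cone T"
proof -
  have "(\<Sum>g\<in>T. \<Sum>h\<in>T. d g * d h * (c * Poly_Mapping.lookup x (g, h))) =
    c * (\<Sum>g\<in>T. \<Sum>h\<in>T. d g * d h * Poly_Mapping.lookup x (g, h))" for d
    by (simp add: sum_distrib_left algebra_simps)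
  then show ?thesis
    using assms(2,3) unfolding sos_cone_iff_psd[OF assms(1)] psd_matrices_def
    by (auto simp flip: sum_distrib_left)
qed

lemma sos_cone_sum:
  assumes "finite T" "\<And>i. i \<in> I \<Longrightarrow> f i \<in> sos_cone T"
  shows "(\<Sum>i\<in>I. f i) \<in> sos_cone T"
  using assms(2)
  by (induction I rule: infinite_finite_induct) (auto intro: sos_cone_zero sos_cone_add[OF assms(1)])

lemma closed_psd_matrices: "closed (psd_matrices T)"
  unfolding psd_matrices_def
  by (intro closed_Collect_conj closed_Collect_all closed_Collect_imp closed_Collect_eq
      closed_Collect_le continuous_intros continuous_on_product_coordinates) auto

lemma compact_box:
  fixes J :: "'i \<Rightarrow> real set"
  assumes "\<And>i. compact (J i)"
  shows "compact {m. \<forall>i. m i \<in> J i}"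
proof -
  have "compactin (product_topology (\<lambda>_. euclidean) UNIV) (PiE UNIV J)"
    using assms by (simp add: compactin_PiE)
  moreover have "PiE UNIV J = {m. \<forall>i. m i \<in> J i}" by auto
  ultimately show ?thesis by (simp add: euclidean_product_topology)
qed

lemma psd_entry_le_trace:
  assumes T: "finite T" and m: "m \<in> psd_matrices T"
  shows "\<bar>m (g, h)\<bar> \<le> (\<Sum>k\<in>T. m (k, k))"
proof -
  obtain n :: nat and w where w: "\<And>g h. g \<in> T \<Longrightarrow> h \<in> T \<Longrightarrow> m (g, h) = (\<Sum>i<n. w i g * w i h)"
    using psd_imp_sum_of_squares[OF T, of "\<lambda>g h. m (g, h)"] m by (auto simp: psd_matrices_def)
  have diag: "0 \<le> m (k, k)" if "k \<in> T" for k using that by (simp add: w sum_nonneg)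
  show ?thesis
  proof (cases "g \<in> T \<and> h \<in> T")
    case False
    then have "m (g, h) = 0" using m by (auto simp: psd_matrices_def)
    then show ?thesis using diag by (simp add: sum_nonneg)
  next
    case True
    have le: "m (k, k) \<le> (\<Sum>k\<in>T. m (k, k))" if "k \<in> T" for k
      using that T diag by (intro member_le_sum) auto
    have "\<bar>m (g, h)\<bar> \<le> (\<Sum>i<n. \<bar>w i g * w i h\<bar>)" using True by (simp add: w sum_abs)
    also have "\<dots> \<le> (\<Sum>i<n. (w i g * w i g + w i h * w i h) / 2)"
    proof (rule sum_mono)
      fix i
      show "\<bar>w i g * w i h\<bar> \<le> (w i g * w i g + w i h * w i h) / 2"
        using sum_squares_bound[of "\<bar>w i g\<bar>" "\<bar>w i h\<bar>"] by (simp add: power2_eq_square abs_mult)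
    qed
    also have "\<dots> = (m (g, g) + m (h, h)) / 2"
      using True by (simp add: w sum.distrib flip: sum_divide_distrib)
    also have "\<dots> \<le> (\<Sum>k\<in>T. m (k, k))" using le[of g] le[of h] True by simp
    finally show ?thesis .
  qed
qed

text \<open>The trace bounds all entries, so the slice is a closed subset of a product of intervals.\<close>

lemma compact_psd_trace:
  assumes T: "finite T"
  shows "compact {m \<in> psd_matrices T. (\<Sum>k\<in>T. m (k, k)) \<le> c}"
proof -
  let ?A = "{m \<in> psd_matrices T. (\<Sum>k\<in>T. m (k, k)) \<le> c}"
  let ?K = "{m :: 'a \<times> 'a \<Rightarrow> real. \<forall>p. m p \<in> {- c..c}}"
  have "m (g, h) \<in> {- c..c}" if "m \<in> ?A" for m g h
    using psd_entry_le_trace[OF T, of m g h] that by (auto simp: abs_le_iff)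
  then have "?A = ?K \<inter> (psd_matrices T \<inter> {m. (\<Sum>k\<in>T. m (k, k)) \<le> c})" by fastforce
  moreover have "closed {m :: 'a \<times> 'a \<Rightarrow> real. (\<Sum>k\<in>T. m (k, k)) \<le> c}"
    by (intro closed_Collect_le continuous_intros continuous_on_product_coordinates)
  ultimately show ?thesis
    using compact_Int_closed[OF compact_box[of "\<lambda>_. {- c..c}"] closed_Int[OF closed_psd_matrices]]
    by simp
qed

section \<open>Hermitian squares in the group ring\<close>

abbreviation point :: "'a \<Rightarrow> 'a \<Rightarrow>\<^sub>0 real" where
  "point g \<equiv> Poly_Mapping.single g 1"

lemma Phi_tensor:
  "Phi G (tensor x y) = (\<Sum>g\<in>Poly_Mapping.keys x. \<Sum>h\<in>Poly_Mapping.keys y.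
     Poly_Mapping.single (inv\<^bsub>G\<^esub> g \<otimes>\<^bsub>G\<^esub> h) (Poly_Mapping.lookup x g * Poly_Mapping.lookup y h))"
proof -
  have "Phi G (Poly_Mapping.single (g, h) c) = Poly_Mapping.single (inv\<^bsub>G\<^esub> g \<otimes>\<^bsub>G\<^esub> h) c" for g h c
    by (cases "c = 0") (simp_all add: Phi_def)
  then show ?thesis by (simp add: tensor_def linear_sum[OF linear_Phi])
qed

lemma lookup_Phi_tensor:
  "Poly_Mapping.lookup (Phi G (tensor x y)) k = (\<Sum>g\<in>Poly_Mapping.keys x. \<Sum>h\<in>Poly_Mapping.keys y.
     if inv\<^bsub>G\<^esub> g \<otimes>\<^bsub>G\<^esub> h = k then Poly_Mapping.lookup x g * Poly_Mapping.lookup y h else 0)"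
  by (simp add: Phi_tensor lookup_sum lookup_single when_def)

lemma lookup_Phi:
  assumes T: "finite T" and z: "Poly_Mapping.keys z \<subseteq> T \<times> T"
  shows "Poly_Mapping.lookup (Phi G z) k =
    (\<Sum>g\<in>T. \<Sum>h\<in>T. if inv\<^bsub>G\<^esub> g \<otimes>\<^bsub>G\<^esub> h = k then Poly_Mapping.lookup z (g, h) else 0)"
proof -
  have "Poly_Mapping.lookup (Phi G z) k = (\<Sum>(g, h)\<in>Poly_Mapping.keys z.
      if inv\<^bsub>G\<^esub> g \<otimes>\<^bsub>G\<^esub> h = k then Poly_Mapping.lookup z (g, h) else 0)"
    by (auto simp: Phi_def lookup_sum lookup_single when_def intro!: sum.cong)
  also have "\<dots> = (\<Sum>(g, h)\<in>T \<times> T.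
      if inv\<^bsub>G\<^esub> g \<otimes>\<^bsub>G\<^esub> h = k then Poly_Mapping.lookup z (g, h) else 0)"
    using T z by (intro sum.mono_neutral_left) (auto simp: in_keys_iff)
  finally show ?thesis by (simp add: sum.cartesian_product)
qed

lemma sos_cone_keys:
  assumes "finite T" "x \<in> sos_cone T"
  shows "Poly_Mapping.keys x \<subseteq> T \<times> T"
  using assms by (auto simp: sos_cone_iff_psd psd_matrices_def in_keys_iff)

lemma aug_diff: "finite T \<Longrightarrow> x \<in> aug T \<Longrightarrow> y \<in> aug T \<Longrightarrow> x - y \<in> aug T"
  using keys_diff[of x y] by (auto simp: aug_iff lookup_minus sum_subtractf)

lemma point_diff_aug:
  assumes "finite T" "g \<in> T" "h \<in> T"
  shows "point g - point h \<in> aug T"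
proof -
  have "Poly_Mapping.keys (point g - point h) \<subseteq> T"
    using keys_diff[of "point g" "point h"] assms by auto
  then show ?thesis
    using assms by (simp add: aug_iff lookup_minus sum_subtractf lookup_single when_def)
qed

text \<open>
  The differences \<open>u - g\<close> provide the finite set of generators that \<open>order_unit_support\<close> asks for.
\<close>

lemma aug_subset_span:
  assumes u: "u \<in> R"
  shows "aug R \<subseteq> span ((\<lambda>g. point u - point g) ` R)"
proof
  fix x :: "'a \<Rightarrow>\<^sub>0 real"
  assume x: "x \<in> aug R"
  let ?K = "Poly_Mapping.keys x"
  have "x = (\<Sum>g\<in>?K. - Poly_Mapping.lookup x g *\<^sub>R (point u - point g))"
  proof (rule poly_mapping_eqI)
    fix k
    have "(\<Sum>g\<in>?K. - Poly_Mapping.lookup x g * ((1 when u = k) - (1 when g = k))) =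
      (\<Sum>g\<in>?K. (if g = k then Poly_Mapping.lookup x g else 0) -
        Poly_Mapping.lookup x g * (1 when u = k))"
      by (intro sum.cong) (auto simp: when_def)
    also have "\<dots> = (\<Sum>g\<in>?K. if g = k then Poly_Mapping.lookup x g else 0)"
      using x by (simp add: sum_subtractf aug_def flip: sum_distrib_right)
    also have "\<dots> = Poly_Mapping.lookup x k" by (simp add: in_keys_iff)
    finally show "Poly_Mapping.lookup x k =
        Poly_Mapping.lookup (\<Sum>g\<in>?K. - Poly_Mapping.lookup x g *\<^sub>R (point u - point g)) k"
      by (simp add: lookup_sum lookup_minus lookup_single)
  qed
  also have "\<dots> \<in> span ((\<lambda>g. point u - point g) ` R)"
    using x by (intro span_sum span_scale span_base) (auto simp: aug_def)
  finally show "x \<in> span ((\<lambda>g. point u - point g) ` R)" .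
qed

lemma tensor_parallelogram:
  "tensor (a + b) (a + b) + tensor (a - b) (a - b) =
     2 *\<^sub>R tensor a a + 2 *\<^sub>R tensor b b"
proof (rule poly_mapping_eqI)
  fix p :: "'a \<times> 'a"
  obtain g h where "p = (g, h)" by fastforce
  then show "Poly_Mapping.lookup (tensor (a + b) (a + b) + tensor (a - b) (a - b)) p =
      Poly_Mapping.lookup (2 *\<^sub>R tensor a a + 2 *\<^sub>R tensor b b) p"
    by (simp add: lookup_tensor lookup_add lookup_minus algebra_simps)
qed

context group
begin

lemma Phi_square_point_diff:
  assumes "g \<in> carrier G" "h \<in> carrier G"
  shows "Phi G (tensor (point g - point h) (point g - point h)) =
    2 *\<^sub>R point \<one> - point (inv g \<otimes> h) - point (inv h \<otimes> g)"
proof -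
  have "tensor (point g - point h) (point g - point h) =
      point (g, g) + point (h, h) - point (g, h) - point (h, g)"
  proof (rule poly_mapping_eqI)
    fix p :: "'a \<times> 'a"
    obtain a b where p: "p = (a, b)" by fastforce
    have "Poly_Mapping.lookup (point (x, y)) (a, b) =
        Poly_Mapping.lookup (point x) a * Poly_Mapping.lookup (point y) b" for x y :: 'a
      by (simp add: lookup_single when_def)
    then show "Poly_Mapping.lookup (tensor (point g - point h) (point g - point h)) p =
        Poly_Mapping.lookup (point (g, g) + point (h, h) - point (g, h) - point (h, g)) p"
      by (simp add: p lookup_tensor lookup_add lookup_minus left_diff_distrib right_diff_distrib)
  qed
  moreover have "2 *\<^sub>R point \<one> = point \<one> + point \<one>" by (simp add: scaleR_2)
  ultimately show ?thesis
    using assms by (simp add: linear_add[OF linear_Phi] linear_diff[OF linear_Phi] Phi_single)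
qed

text \<open>
  Exchanging the two tensor factors corresponds under \<open>\<Phi>\<close> to the involution \<open>g \<mapsto> g\<^sup>-\<^sup>1\<close> of the group
  ring.
\<close>

lemma lookup_Phi_tensor_inv:
  assumes "Poly_Mapping.keys x \<subseteq> carrier G" "Poly_Mapping.keys y \<subseteq> carrier G" "k \<in> carrier G"
  shows "Poly_Mapping.lookup (Phi G (tensor x y)) (inv k) =
    Poly_Mapping.lookup (Phi G (tensor y x)) k"
proof -
  have "inv g \<otimes> h = inv k \<longleftrightarrow> inv h \<otimes> g = k"
    if "g \<in> Poly_Mapping.keys x" "h \<in> Poly_Mapping.keys y" for g h
  proof -
    have gh: "g \<in> carrier G" "h \<in> carrier G" using that assms by auto
    then have "inv g \<otimes> h = inv (inv h \<otimes> g)" by (simp add: inv_mult_group)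
    then show ?thesis using gh assms(3) by (metis inv_closed inv_inv m_closed)
  qed
  then have "Poly_Mapping.lookup (Phi G (tensor x y)) (inv k) =
    (\<Sum>g\<in>Poly_Mapping.keys x. \<Sum>h\<in>Poly_Mapping.keys y.
       if inv h \<otimes> g = k then Poly_Mapping.lookup y h * Poly_Mapping.lookup x g else 0)"
    unfolding lookup_Phi_tensor by (intro sum.cong) auto
  also have "\<dots> = Poly_Mapping.lookup (Phi G (tensor y x)) k"
    unfolding lookup_Phi_tensor by (rule sum.swap)
  finally show ?thesis .
qed

lemma gr_mult_eq_Phi_tensor:
  assumes x: "Poly_Mapping.keys x \<subseteq> carrier G"
    and sym: "\<And>k. k \<in> carrier G \<Longrightarrow> Poly_Mapping.lookup x (inv k) = Poly_Mapping.lookup x k"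
  shows "gr_mult G x y = Phi G (tensor x y)"
  unfolding gr_mult_def Phi_tensor
proof (rule sum.reindex_bij_witness[where i = "\<lambda>g. inv g" and j = "\<lambda>g. inv g"], goal_cases)
  case (2 g) then show ?case using x sym[of g] by (auto simp: in_keys_iff)
next
  case (4 g) then show ?case using x sym[of g] by (auto simp: in_keys_iff)
next
  case (5 g)
  then have "g \<in> carrier G" using x by auto
  then show ?case using sym[of g] by simp
qed (use x in auto)

text \<open>The \<open>-1\<close> eigenspace of the involution of the group ring that extends \<open>g \<mapsto> g\<^sup>-\<^sup>1\<close> linearly.\<close>

definition skew :: "('a \<Rightarrow>\<^sub>0 real) set" where
  "skew = {a. Poly_Mapping.keys a \<subseteq> carrier G \<and>
     (\<forall>k\<in>carrier G. Poly_Mapping.lookup a (inv k) = - Poly_Mapping.lookup a k)}"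

lemma skew_zero: "0 \<in> skew"
  by (simp add: skew_def)

lemma skew_add: "a \<in> skew \<Longrightarrow> b \<in> skew \<Longrightarrow> a + b \<in> skew"
  using Poly_Mapping.keys_add[of a b] by (auto simp: skew_def lookup_add)

lemma skew_scale: "a \<in> skew \<Longrightarrow> c *\<^sub>R a \<in> skew"
  by (auto simp: skew_def in_keys_iff)

lemma skew_point_diff:
  assumes "g \<in> carrier G"
  shows "point (inv g) - point g \<in> skew"
proof -
  have "inv g = inv k \<longleftrightarrow> g = k" "g = inv k \<longleftrightarrow> inv g = k" if "k \<in> carrier G" for k
    using that assms by (metis inv_inv)+
  then show ?thesis using assms
    by (auto simp: skew_def lookup_minus lookup_single when_def in_keys_iff split: if_splits)
qed

lemma lookup_skew_one: "a \<in> skew \<Longrightarrow> Poly_Mapping.lookup a \<one> = 0"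
  by (auto simp: skew_def dest: bspec[of _ _ \<one>])

lemma skew_self_adjoint_eq_0:
  assumes "a \<in> skew"
    and "\<And>k. k \<in> carrier G \<Longrightarrow> Poly_Mapping.lookup a (inv k) = Poly_Mapping.lookup a k"
  shows "a = 0"
proof (rule poly_mapping_eqI)
  fix k
  show "Poly_Mapping.lookup a k = Poly_Mapping.lookup 0 k"
  proof (cases "k \<in> carrier G")
    case True
    then show ?thesis using assms by (force simp: skew_def)
  next
    case False
    then show ?thesis using assms(1) by (auto simp: skew_def in_keys_iff)
  qed
qed

end

locale cayley_support = group G for G :: "('a, 'b) monoid_scheme" (structure) +
  fixes S T :: "'a set"
  assumes finite_S: "finite S" and S_carrier: "S \<subseteq> carrier G" and set_inv_S: "set_inv S = S"
    and generate_S: "generate G S = carrier G"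
    and T_support: "T \<in> connected_supports G S"
begin

abbreviation "\<Delta> \<equiv> laplacian G S"
abbreviation "R \<equiv> set_inv T <#> T"

lemma finite_T: "finite T" and T_carrier: "T \<subseteq> carrier G" and one_T: "\<one> \<in> T" and S_T: "S \<subseteq> T"
  and T_connected: "g \<in> T \<Longrightarrow> h \<in> T \<Longrightarrow> (g, h) \<in> (cayley_adj G S T)\<^sup>*"
  using T_support by (auto simp: connected_supports_def)

lemma R_iff: "k \<in> R \<longleftrightarrow> (\<exists>g\<in>T. \<exists>h\<in>T. k = inv g \<otimes> h)"
  by (simp add: set_mult_def SET_INV_def)

lemma finite_R: "finite R"
proof -
  have "R = (\<lambda>(g, h). inv g \<otimes> h) ` (T \<times> T)" by (fastforce simp: R_iff image_iff)
  then show ?thesis using finite_T by simp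
qed

lemma inv_mem_S: "s \<in> S \<Longrightarrow> inv s \<in> S"
  using set_inv_S by (auto simp: SET_INV_def)

lemma inv_mem_S_iff: "k \<in> carrier G \<Longrightarrow> inv k \<in> S \<longleftrightarrow> k \<in> S"
  using inv_mem_S by (metis inv_inv)

lemma aug_carrier: "x \<in> aug T \<Longrightarrow> Poly_Mapping.keys x \<subseteq> carrier G"
  using T_carrier by (auto simp: aug_def)

lemma lookup_laplacian:
  "Poly_Mapping.lookup \<Delta> k = (if k = \<one> then real (card S) else 0) - (if k \<in> S then 1 else 0)"
  using finite_S by (simp add: laplacian_def lookup_minus lookup_sum lookup_single when_def)

lemma laplacian_self_adjoint:
  "k \<in> carrier G \<Longrightarrow> Poly_Mapping.lookup \<Delta> (inv k) = Poly_Mapping.lookup \<Delta> k"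
  by (simp add: lookup_laplacian inv_mem_S_iff)

lemma laplacian_aug: "\<Delta> \<in> aug T"
proof -
  have "Poly_Mapping.keys \<Delta> \<subseteq> T"
    using one_T S_T by (auto simp: in_keys_iff lookup_laplacian split: if_splits)
  moreover have "(\<Sum>k\<in>T. Poly_Mapping.lookup \<Delta> k) = 0"
    using finite_T one_T S_T
    by (simp add: lookup_laplacian sum_subtractf Int_absorb1 flip: sum.inter_restrict)
  ultimately show ?thesis by (simp add: aug_iff finite_T)
qed

lemma laplacian_squared: "gr_mult G \<Delta> \<Delta> = Phi G (tensor \<Delta> \<Delta>)"
  using aug_carrier[OF laplacian_aug] laplacian_self_adjoint by (rule gr_mult_eq_Phi_tensor)

lemma laplacian_sum_of_squares:
  "2 *\<^sub>R \<Delta> = (\<Sum>s\<in>S. Phi G (tensor (point \<one> - point s) (point \<one> - point s)))"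
proof -
  have "(\<Sum>s\<in>S. point (inv s)) = (\<Sum>s\<in>S. point s)"
    by (rule sum.reindex_bij_witness[where i = "\<lambda>g. inv g" and j = "\<lambda>g. inv g"])
      (use inv_mem_S S_carrier in auto)
  moreover have "(\<Sum>s\<in>S. Phi G (tensor (point \<one> - point s) (point \<one> - point s))) =
      (\<Sum>s\<in>S. 2 *\<^sub>R point \<one> - point s - point (inv s))"
    using S_carrier by (intro sum.cong refl, subst Phi_square_point_diff) auto
  ultimately show ?thesis
    by (simp add: sum_subtractf laplacian_def scaleR_diff_right sum_constant_scaleR
        scaleR_2[of "sum _ _"])
qed

text \<open>
  A generating set of a non-trivial group contains some \<open>s \<noteq> \<one>\<close>. If \<open>\<one> \<in> S\<close>, its contribution to
  \<open>\<Delta>\<close> cancels.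
\<close>

lemma lookup_laplacian_one_pos:
  assumes "carrier G \<noteq> {\<one>}"
  shows "0 < Poly_Mapping.lookup \<Delta> \<one>"
proof -
  have "\<not> S \<subseteq> {\<one>}"
    using assms generate_S generate_one generate_empty by (metis subset_singletonD)
  then obtain s where s: "s \<in> S" "s \<noteq> \<one>" by blast
  show ?thesis
  proof (cases "\<one> \<in> S")
    case True
    have "card {\<one>, s} \<le> card S" using s True finite_S by (intro card_mono) auto
    then show ?thesis using s by (simp add: lookup_laplacian)
  next
    case False
    then show ?thesis using s finite_S by (auto simp: lookup_laplacian card_gt_0_iff)
  qed
qed

lemma Phi_tensor_aug:
  assumes "x \<in> aug T" "y \<in> aug T"
  shows "Phi G (tensor x y) \<in> aug R"
proof -
  let ?X = "Poly_Mapping.keys x" and ?Y = "Poly_Mapping.keys y"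
  have R: "inv g \<otimes> h \<in> R" if "g \<in> ?X" "h \<in> ?Y" for g h
    using that assms by (auto simp: aug_def R_iff)
  have "Poly_Mapping.keys (Phi G (tensor x y)) \<subseteq> R"
  proof
    fix k assume k: "k \<in> Poly_Mapping.keys (Phi G (tensor x y))"
    show "k \<in> R"
    proof (rule ccontr)
      assume "k \<notin> R"
      then have "Poly_Mapping.lookup (Phi G (tensor x y)) k = 0"
        unfolding lookup_Phi_tensor using R by (intro sum.neutral ballI) auto
      then show False using k by (simp add: in_keys_iff)
    qed
  qed
  moreover have "(\<Sum>k\<in>R. Poly_Mapping.lookup (Phi G (tensor x y)) k) = 0"
  proof -
    have "(\<Sum>k\<in>R. Poly_Mapping.lookup (Phi G (tensor x y)) k) = (\<Sum>g\<in>?X. \<Sum>h\<in>?Y. \<Sum>k\<in>R.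
        if inv g \<otimes> h = k then Poly_Mapping.lookup x g * Poly_Mapping.lookup y h else 0)"
      unfolding lookup_Phi_tensor by (simp add: sum.swap[of _ _ R])
    also have "\<dots> = (\<Sum>g\<in>?X. \<Sum>h\<in>?Y. Poly_Mapping.lookup x g * Poly_Mapping.lookup y h)"
      using R finite_R by (intro sum.cong refl) simp
    also have "\<dots> = 0" using assms by (simp add: aug_def flip: sum_product)
    finally show ?thesis .
  qed
  ultimately show ?thesis by (simp add: aug_iff finite_R)
qed

lemma Phi_sos_self_adjoint:
  assumes "x \<in> sos_cone T" "k \<in> carrier G"
  shows "Poly_Mapping.lookup (Phi G x) (inv k) = Poly_Mapping.lookup (Phi G x) k"
proof -
  obtain n :: nat and w where "x = (\<Sum>i<n. tensor (w i) (w i))" "\<forall>i<n. w i \<in> aug T"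
    using assms(1) by (auto simp: sos_cone_def)
  then show ?thesis
    using assms(2) aug_carrier
    by (auto simp: linear_sum[OF linear_Phi] lookup_sum lookup_Phi_tensor_inv intro!: sum.cong)
qed

text \<open>
  This identity is what links the group ring to matrices: the coefficient at \<open>\<one>\<close> is a faithful
  positive functional on sums of squares.
\<close>

lemma Phi_sos_trace:
  assumes "x \<in> sos_cone T"
  shows "Poly_Mapping.lookup (Phi G x) \<one> = (\<Sum>g\<in>T. Poly_Mapping.lookup x (g, g))"
proof -
  have "inv g \<otimes> h = \<one> \<longleftrightarrow> g = h" if "g \<in> T" "h \<in> T" for g h
    using that T_carrier by (metis inv_equality inv_closed inv_inv l_inv subsetD)
  then have "Poly_Mapping.lookup (Phi G x) \<one> =
      (\<Sum>g\<in>T. \<Sum>h\<in>T. if g = h then Poly_Mapping.lookup x (g, h) else 0)"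
    unfolding lookup_Phi[OF finite_T sos_cone_keys[OF finite_T assms]] by (intro sum.cong) auto
  then show ?thesis using finite_T by simp
qed

section \<open>The Laplacian as an order unit\<close>

text \<open>
  Induction along a path in \<open>T\<close> from \<open>g\<close>. Squares of sums are dominated through
  \<open>2 a\<^sup>2 + 2 b\<^sup>2 - (a + b)\<^sup>2 = (a - b)\<^sup>2\<close>.
\<close>

lemma laplacian_dominates:
  assumes "g \<in> T" "h \<in> T"
  shows "\<exists>t. \<exists>x\<in>sos_cone T.
    t *\<^sub>R \<Delta> = Phi G x + Phi G (tensor (point g - point h) (point g - point h))"
  using T_connected[OF assms]
proof (induction rule: rtrancl_induct)
  case base
  have "tensor (0 :: 'a \<Rightarrow>\<^sub>0 real) 0 = 0" by (simp add: tensor_def)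
  then show ?case using sos_cone_zero
    by (intro exI[of _ 0] bexI[of _ 0]) (simp_all add: linear_0[OF linear_Phi])
next
  case (step h k)
  then obtain t x where x: "x \<in> sos_cone T"
    and tx: "t *\<^sub>R \<Delta> = Phi G x + Phi G (tensor (point g - point h) (point g - point h))"
    by blast
  obtain s where s: "s \<in> S" "k = h \<otimes> s" and hk: "h \<in> T" "k \<in> T"
    using step(2) by (auto simp: cayley_adj_def)
  define a where "a = point g - point h"
  define b where "b = point h - point k"
  have carr: "h \<in> carrier G" "s \<in> carrier G" using hk s S_carrier T_carrier by auto
  have ab: "a \<in> aug T" "b \<in> aug T"
    unfolding a_def b_def using assms hk finite_T by (auto intro: point_diff_aug)
  \<comment> \<open>Left translation does not change \<open>\<Phi>(\<omega> \<otimes> \<omega>)\<close>, so the edge contributes a summand of \<open>2\<Delta>\<close>.\<close>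
  have "inv h \<otimes> k = s" "inv k \<otimes> h = inv s"
    using carr s by (simp_all add: m_assoc[symmetric] inv_mult_group) (simp add: m_assoc)
  then have bb: "Phi G (tensor b b) = Phi G (tensor (point \<one> - point s) (point \<one> - point s))"
    unfolding b_def using carr s by (simp add: Phi_square_point_diff)
  define y where "y = (\<Sum>s\<in>S - {s}. tensor (point \<one> - point s) (point \<one> - point s))"
  have y: "y \<in> sos_cone T"
    unfolding y_def using S_T one_T finite_T
    by (intro sos_cone_sum sos_cone_square point_diff_aug) auto
  have ty: "2 *\<^sub>R \<Delta> = Phi G y + Phi G (tensor b b)"
    unfolding laplacian_sum_of_squares bb y_def using s finite_S
    by (simp add: linear_sum[OF linear_Phi] sum.remove add.commute)
  have "(2 * t + 4) *\<^sub>R \<Delta> = 2 *\<^sub>R (t *\<^sub>R \<Delta>) + 2 *\<^sub>R (2 *\<^sub>R \<Delta>)" by (simp add: algebra_simps)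
  also have "\<dots> = Phi G (2 *\<^sub>R x + 2 *\<^sub>R y + (2 *\<^sub>R tensor a a + 2 *\<^sub>R tensor b b))"
    unfolding tx ty a_def[symmetric]
    by (simp add: linear_add[OF linear_Phi] linear_scale[OF linear_Phi] scaleR_add_right add_ac)
  also have "\<dots> = Phi G (2 *\<^sub>R x + 2 *\<^sub>R y + tensor (a - b) (a - b)) +
      Phi G (tensor (a + b) (a + b))"
    by (simp add: tensor_parallelogram[symmetric] linear_add[OF linear_Phi] add_ac)
  finally have "(2 * t + 4) *\<^sub>R \<Delta> = Phi G (2 *\<^sub>R x + 2 *\<^sub>R y + tensor (a - b) (a - b)) +
      Phi G (tensor (a + b) (a + b))" .
  moreover have "2 *\<^sub>R x + 2 *\<^sub>R y + tensor (a - b) (a - b) \<in> sos_cone T"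
    using x y ab finite_T by (intro sos_cone_add sos_cone_scale sos_cone_square aug_diff) auto
  moreover have "a + b = point g - point k" by (simp add: a_def b_def)
  ultimately show ?case by metis
qed

text \<open>
  The skew-adjoint summand makes \<open>\<Delta>\<close> an order unit of all of \<open>I[T\<^sup>-\<^sup>1T]\<close>, whereas sums of squares
  span only self-adjoint elements.
\<close>

definition certificates :: "('a \<Rightarrow>\<^sub>0 real) set" where
  "certificates = {Phi G x + a | x a. x \<in> sos_cone T \<and> a \<in> skew}"

lemma certificatesI: "x \<in> sos_cone T \<Longrightarrow> a \<in> skew \<Longrightarrow> Phi G x + a \<in> certificates"
  by (auto simp: certificates_def)

lemma Phi_sos_certificate: "x \<in> sos_cone T \<Longrightarrow> Phi G x \<in> certificates"
  using certificatesI[OF _ skew_zero] by force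

lemma skew_certificate: "a \<in> skew \<Longrightarrow> a \<in> certificates"
  using certificatesI[OF sos_cone_zero] by (force simp: linear_0[OF linear_Phi])

lemma certificates_add:
  assumes "u \<in> certificates" "v \<in> certificates"
  shows "u + v \<in> certificates"
proof -
  obtain x a y b where u: "u = Phi G x + a" and v: "v = Phi G y + b"
    and xy: "x \<in> sos_cone T" "y \<in> sos_cone T" and ab: "a \<in> skew" "b \<in> skew"
    using assms by (auto simp: certificates_def)
  have "u + v = Phi G (x + y) + (a + b)" by (simp add: u v linear_add[OF linear_Phi])
  then show ?thesis
    using certificatesI[OF sos_cone_add[OF finite_T xy] skew_add[OF ab]] by simp
qed

lemma certificates_scale:
  assumes "u \<in> certificates" "c \<ge> 0"
  shows "c *\<^sub>R u \<in> certificates"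
proof -
  obtain x a where u: "u = Phi G x + a" and x: "x \<in> sos_cone T" and a: "a \<in> skew"
    using assms by (auto simp: certificates_def)
  have "c *\<^sub>R u = Phi G (c *\<^sub>R x) + c *\<^sub>R a"
    by (simp add: u linear_scale[OF linear_Phi] scaleR_add_right)
  then show ?thesis
    using certificatesI[OF sos_cone_scale[OF finite_T x assms(2)] skew_scale[OF a]] by simp
qed

text \<open>
  The skew-adjoint summand of a self-adjoint element is self-adjoint as well, hence zero.
\<close>

lemma certificate_self_adjoint_iff:
  assumes "\<And>k. k \<in> carrier G \<Longrightarrow> Poly_Mapping.lookup v (inv k) = Poly_Mapping.lookup v k"
  shows "v \<in> certificates \<longleftrightarrow> (\<exists>x\<in>sos_cone T. Phi G x = v)"
proof
  assume "v \<in> certificates"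
  then obtain x a where va: "v = Phi G x + a" and x: "x \<in> sos_cone T" and a: "a \<in> skew"
    by (auto simp: certificates_def)
  have "Poly_Mapping.lookup a (inv k) = Poly_Mapping.lookup a k" if "k \<in> carrier G" for k
    using assms[OF that] Phi_sos_self_adjoint[OF x that] by (simp add: va lookup_add)
  then have "a = 0" using skew_self_adjoint_eq_0[OF a] by blast
  then show "\<exists>x\<in>sos_cone T. Phi G x = v" using va x by auto
qed (use Phi_sos_certificate in auto)

lemma neg_laplacian_not_certificate:
  assumes "carrier G \<noteq> {\<one>}"
  shows "- \<Delta> \<notin> certificates"
proof
  assume "- \<Delta> \<in> certificates"
  then obtain x a where xa: "- \<Delta> = Phi G x + a" and x: "x \<in> sos_cone T" and a: "a \<in> skew"
    by (auto simp: certificates_def)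
  have "- Poly_Mapping.lookup \<Delta> \<one> = (\<Sum>g\<in>T. Poly_Mapping.lookup x (g, g))"
    using arg_cong[OF xa, of "\<lambda>v. Poly_Mapping.lookup v \<one>"] lookup_skew_one[OF a] Phi_sos_trace[OF x]
    by (simp add: lookup_add)
  moreover have "0 \<le> (\<Sum>g\<in>T. Poly_Mapping.lookup x (g, g))"
    using psd_entry_le_trace[OF finite_T, of "Poly_Mapping.lookup x" \<one> \<one>] x
    by (simp add: sos_cone_iff_psd[OF finite_T])
  ultimately show False using lookup_laplacian_one_pos[OF assms] by simp
qed

text \<open>
  Both signs follow from \<open>1 - k = (2 - k - k\<^sup>-\<^sup>1) / 2 + (k\<^sup>-\<^sup>1 - k) / 2\<close>, where the first summand is half of
  the square of \<open>g - h\<close> and the second is skew-adjoint.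
\<close>

lemma laplacian_order_unit:
  assumes "k \<in> R"
  shows "\<exists>t. t *\<^sub>R \<Delta> + (point \<one> - point k) \<in> certificates"
    and "\<exists>t. t *\<^sub>R \<Delta> - (point \<one> - point k) \<in> certificates"
proof -
  obtain g h where gh: "g \<in> T" "h \<in> T" "k = inv g \<otimes> h" using assms by (auto simp: R_iff)
  have carr: "g \<in> carrier G" "h \<in> carrier G" "k \<in> carrier G" using gh T_carrier by auto
  define d where "d = point g - point h"
  have d: "d \<in> aug T" using gh finite_T by (auto simp: d_def intro: point_diff_aug)
  have "inv k = inv h \<otimes> g" using carr gh by (simp add: inv_mult_group)
  then have dd: "Phi G (tensor d d) = 2 *\<^sub>R point \<one> - point k - point (inv k)"
    using carr gh by (simp add: d_def Phi_square_point_diff)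
  have k: "point \<one> - point k = (1/2) *\<^sub>R Phi G (tensor d d) + (1/2) *\<^sub>R (point (inv k) - point k)"
    by (intro poly_mapping_eqI) (simp add: dd lookup_add lookup_minus field_simps)
  have "(1/2) *\<^sub>R Phi G (tensor d d) \<in> certificates"
    using d by (auto intro!: certificates_scale Phi_sos_certificate sos_cone_square)
  moreover have skew: "c *\<^sub>R (point (inv k) - point k) \<in> certificates" for c
    using carr by (auto intro!: skew_certificate skew_scale skew_point_diff)
  ultimately have "0 *\<^sub>R \<Delta> + (point \<one> - point k) \<in> certificates"
    using k certificates_add by simp
  then show "\<exists>t. t *\<^sub>R \<Delta> + (point \<one> - point k) \<in> certificates" by blast
  obtain t x where x: "x \<in> sos_cone T" and t: "t *\<^sub>R \<Delta> = Phi G x + Phi G (tensor d d)"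
    using laplacian_dominates[OF gh(1,2)] by (auto simp: d_def)
  have "(t / 2) *\<^sub>R \<Delta> = (1/2) *\<^sub>R (t *\<^sub>R \<Delta>)" by simp
  then have "(t / 2) *\<^sub>R \<Delta> - (point \<one> - point k) =
      (1/2) *\<^sub>R Phi G x + (- 1/2) *\<^sub>R (point (inv k) - point k)"
    unfolding t k by (simp add: scaleR_add_right)
  moreover have "(1/2) *\<^sub>R Phi G x + (- 1/2) *\<^sub>R (point (inv k) - point k) \<in> certificates"
    using x by (intro certificates_add skew certificates_scale Phi_sos_certificate) auto
  ultimately show "\<exists>t. t *\<^sub>R \<Delta> - (point \<one> - point k) \<in> certificates" by metis
qed

section \<open>Strong duality\<close>

abbreviation "\<Delta>2 \<equiv> gr_mult G \<Delta> \<Delta>"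
abbreviation "E \<equiv> {\<epsilon>. \<exists>x\<in>sos_cone T. Phi G x = \<Delta>2 + \<epsilon> *\<^sub>R \<Delta>}"

lemma certificate_iff_E: "\<Delta>2 + \<epsilon> *\<^sub>R \<Delta> \<in> certificates \<longleftrightarrow> \<epsilon> \<in> E"
proof -
  have "Poly_Mapping.lookup (\<Delta>2 + \<epsilon> *\<^sub>R \<Delta>) (inv k) = Poly_Mapping.lookup (\<Delta>2 + \<epsilon> *\<^sub>R \<Delta>) k"
    if "k \<in> carrier G" for k
    using that aug_carrier[OF laplacian_aug]
    by (simp add: lookup_add laplacian_squared lookup_Phi_tensor_inv laplacian_self_adjoint)
  then show ?thesis by (simp add: certificate_self_adjoint_iff)
qed

lemma laplacian_aug_R: "\<Delta> \<in> aug R"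
proof -
  have "T \<subseteq> R" using one_T T_carrier by (force simp: R_iff intro: bexI[of _ \<one>])
  then show ?thesis using laplacian_aug by (auto simp: aug_def)
qed

text \<open>
  A functional that is nonnegative on \<open>skew\<close> vanishes there, because \<open>skew\<close> is a subspace; applied to
  \<open>\<Phi>(\<omega> \<otimes> \<eta>) - \<Phi>(\<eta> \<otimes> \<omega>)\<close> this is the symmetry required of a feasible functional.
\<close>

lemma dual_attained:
  assumes "carrier G \<noteq> {\<one>}"
  shows "E \<noteq> {}" and "\<exists>x'\<in>dual_feasible G S T. x' \<Delta>2 = - Inf E"
proof -
  let ?B = "(\<lambda>k. point \<one> - point k) ` R"
  have "\<one> \<in> R" using one_T by (force simp: R_iff intro: bexI[of _ \<one>])
  then have aug_V: "aug R \<subseteq> span ?B" by (rule aug_subset_span)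
  have "\<Delta> \<in> span ?B" using aug_V laplacian_aug_R by blast
  moreover have "\<Delta>2 \<in> span ?B"
    using aug_V Phi_tensor_aug[OF laplacian_aug laplacian_aug] by (auto simp: laplacian_squared)
  ultimately have *: "(\<exists>t. \<Delta>2 + t *\<^sub>R \<Delta> \<in> certificates) \<and>
    (\<exists>f. linear_functional_on (span ?B) f \<and> f \<Delta> = 1 \<and> (\<forall>x\<in>certificates \<inter> span ?B. 0 \<le> f x) \<and>
         f \<Delta>2 = - Inf {t. \<Delta>2 + t *\<^sub>R \<Delta> \<in> certificates})"
    using laplacian_order_unit finite_R neg_laplacian_not_certificate[OF assms]
      skew_certificate[OF skew_zero]
    by (intro order_unit_support certificates_add certificates_scale) auto
  then show "E \<noteq> {}" by (auto simp: certificate_iff_E)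
  obtain f where lin: "linear_functional_on (span ?B) f" and f1: "f \<Delta> = 1"
    and pos: "\<And>x. x \<in> certificates \<Longrightarrow> x \<in> span ?B \<Longrightarrow> 0 \<le> f x"
    and val: "f \<Delta>2 = - Inf {t. \<Delta>2 + t *\<^sub>R \<Delta> \<in> certificates}"
    using * by blast
  have fneg: "f (- x) = - f x" if "x \<in> span ?B" for x
    using lin that unfolding linear_functional_on_def
    by (metis mult_minus_left mult_1 scaleR_minus1_left)
  have fadd: "f (x + y) = f x + f y" if "x \<in> span ?B" "y \<in> span ?B" for x y
    using lin that unfolding linear_functional_on_def by blast
  have sym: "f (Phi G (tensor \<omega> \<eta>)) = f (Phi G (tensor \<eta> \<omega>))"
    if "\<omega> \<in> aug T" "\<eta> \<in> aug T" for \<omega> \<eta>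
  proof -
    let ?u = "Phi G (tensor \<omega> \<eta>)" and ?v = "Phi G (tensor \<eta> \<omega>)"
    have V: "?u \<in> span ?B" "?v \<in> span ?B" using aug_V Phi_tensor_aug that by auto
    have "Poly_Mapping.keys ?u \<subseteq> carrier G" "Poly_Mapping.keys ?v \<subseteq> carrier G"
      using Phi_tensor_aug[OF that] Phi_tensor_aug[OF that(2,1)] T_carrier
      by (auto simp: aug_def R_iff subset_iff)
    then have "?u - ?v \<in> skew"
      using that aug_carrier keys_diff[of ?u ?v]
      by (auto simp: skew_def lookup_minus lookup_Phi_tensor_inv)
    then have "0 \<le> f (?u - ?v)" "0 \<le> f (- (?u - ?v))"
      using V skew_scale[of "?u - ?v" "-1"]
      by (auto intro!: pos skew_certificate span_diff span_neg)
    then have "f (?u - ?v) = 0" using fneg[of "?u - ?v"] V by (simp add: span_diff)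
    then show ?thesis using fadd[of ?u "- ?v"] fneg[of ?v] V by (simp add: span_neg)
  qed
  have "f \<in> dual_feasible G S T"
    unfolding dual_feasible_def
  proof (intro CollectI conjI ballI)
    show "linear_functional_on (aug R) f"
      using lin aug_V unfolding linear_functional_on_def by blast
    fix \<omega> assume "\<omega> \<in> aug T"
    then show "0 \<le> f (Phi G (tensor \<omega> \<omega>))"
      using aug_V Phi_tensor_aug by (auto intro!: pos Phi_sos_certificate sos_cone_square)
  qed (use f1 sym in auto)
  then show "\<exists>x'\<in>dual_feasible G S T. x' \<Delta>2 = - Inf E"
    using val by (auto simp: certificate_iff_E)
qed

text \<open>
  Comparing coefficients at \<open>\<one>\<close> expresses \<open>\<epsilon>\<close> through the trace of the matrix, so minimising over
  \<open>\<epsilon>\<close> becomes minimising a continuous function over matrices. Starting from one admissible \<open>\<epsilon>1\<close>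
  bounds the trace and makes the domain compact.
\<close>

lemma E_attained:
  assumes "carrier G \<noteq> {\<one>}"
  shows "\<exists>\<epsilon>0\<in>E. \<forall>\<epsilon>\<in>E. \<epsilon>0 \<le> \<epsilon>"
proof -
  let ?l = "Poly_Mapping.lookup \<Delta>" and ?l2 = "Poly_Mapping.lookup \<Delta>2"
  have pos: "0 < ?l \<one>" by (rule lookup_laplacian_one_pos[OF assms])
  define tr where "tr m = (\<Sum>k\<in>T. m (k, k))" for m :: "'a \<times> 'a \<Rightarrow> real"
  define \<epsilon>_of where "\<epsilon>_of m = (tr m - ?l2 \<one>) / ?l \<one>" for m
  define P where "P m k = (\<Sum>g\<in>T. \<Sum>h\<in>T. if inv g \<otimes> h = k then m (g, h) else 0)"
    for m :: "'a \<times> 'a \<Rightarrow> real" and k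
  define D where "D = {m \<in> psd_matrices T. \<forall>k. P m k = ?l2 k + \<epsilon>_of m * ?l k}"
  have DI: "Poly_Mapping.lookup x \<in> D \<and> \<epsilon>_of (Poly_Mapping.lookup x) = \<epsilon>"
    if x: "x \<in> sos_cone T" "Phi G x = \<Delta>2 + \<epsilon> *\<^sub>R \<Delta>" for x \<epsilon>
  proof -
    have "tr (Poly_Mapping.lookup x) = ?l2 \<one> + \<epsilon> * ?l \<one>"
      using Phi_sos_trace[OF x(1)] x(2) by (simp add: tr_def lookup_add)
    then have "\<epsilon>_of (Poly_Mapping.lookup x) = \<epsilon>" using pos by (simp add: \<epsilon>_of_def)
    moreover have "P (Poly_Mapping.lookup x) k = ?l2 k + \<epsilon> * ?l k" for k
      using lookup_Phi[OF finite_T sos_cone_keys[OF finite_T x(1)], of G k] x(2)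
      by (simp add: P_def lookup_add)
    ultimately show ?thesis using x(1) by (simp add: D_def sos_cone_iff_psd[OF finite_T])
  qed
  have DE: "\<epsilon>_of m \<in> E" if m: "m \<in> D" for m
  proof -
    have "{p. m p \<noteq> 0} \<subseteq> T \<times> T" using m unfolding D_def psd_matrices_def by blast
    then have "finite {p. m p \<noteq> 0}" using finite_T by (simp add: finite_subset)
    then obtain x where x: "Poly_Mapping.lookup x = m" by (metis lookup_Abs_poly_mapping)
    then have xs: "x \<in> sos_cone T" using m by (simp add: D_def sos_cone_iff_psd[OF finite_T])
    have "Poly_Mapping.lookup (Phi G x) k = P m k" for k
      unfolding P_def x[symmetric] by (rule lookup_Phi[OF finite_T sos_cone_keys[OF finite_T xs]])
    then have "Phi G x = \<Delta>2 + \<epsilon>_of m *\<^sub>R \<Delta>"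
      using m by (intro poly_mapping_eqI) (simp add: D_def lookup_add)
    then show ?thesis using xs by blast
  qed
  obtain \<epsilon>1 where e1: "\<epsilon>1 \<in> E" using dual_attained(1)[OF assms] by blast
  define A where "A = {m \<in> psd_matrices T. tr m \<le> ?l2 \<one> + \<epsilon>1 * ?l \<one>} \<inter>
    {m. \<forall>k. P m k = ?l2 k + \<epsilon>_of m * ?l k}"
  have A: "m \<in> A \<longleftrightarrow> m \<in> D \<and> \<epsilon>_of m \<le> \<epsilon>1" for m
    using pos by (auto simp: A_def D_def \<epsilon>_of_def field_simps)
  have cont: "continuous_on UNIV \<epsilon>_of" "continuous_on UNIV (\<lambda>m. P m k)" for k
  proof -
    show "continuous_on UNIV \<epsilon>_of"
      unfolding \<epsilon>_of_def tr_def
      using pos by (intro continuous_intros continuous_on_product_coordinates) auto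
    have "continuous_on UNIV (\<lambda>m :: 'a \<times> 'a \<Rightarrow> real. if inv g \<otimes> h = k then m (g, h) else 0)" for g h
      by (cases "inv g \<otimes> h = k") auto
    then show "continuous_on UNIV (\<lambda>m. P m k)"
      unfolding P_def by (intro continuous_on_sum)
  qed
  have "compact A"
    unfolding A_def tr_def
    by (intro compact_Int_closed compact_psd_trace finite_T closed_Collect_all closed_Collect_eq
        continuous_intros cont)
  moreover have "A \<noteq> {}" using e1 DI A by fastforce
  moreover have "continuous_on A \<epsilon>_of" using cont(1) continuous_on_subset by blast
  ultimately obtain m where m: "m \<in> A" "\<forall>m'\<in>A. \<epsilon>_of m \<le> \<epsilon>_of m'"
    using continuous_attains_inf by blast
  have "\<epsilon>_of m \<le> \<epsilon>" if "\<epsilon> \<in> E" for \<epsilon>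
  proof (cases "\<epsilon> \<le> \<epsilon>1")
    case True
    then show ?thesis using that DI A m(2) by fastforce
  qed (use m(1) A in force)
  moreover have "\<epsilon>_of m \<in> E" using DE m(1) A by blast
  ultimately show ?thesis by blast
qed

lemma weak_duality:
  assumes x': "x' \<in> dual_feasible G S T" and "\<epsilon> \<in> E"
  shows "- \<epsilon> \<le> x' \<Delta>2"
proof -
  have lin: "x' (u + v) = x' u + x' v" "x' (c *\<^sub>R u) = c * x' u"
    if "u \<in> aug R" "v \<in> aug R" for u v c
    using x' that unfolding dual_feasible_def linear_functional_on_def by blast+
  have aug_add: "u + v \<in> aug R" if "u \<in> aug R" "v \<in> aug R" for u v
    using that finite_R Poly_Mapping.keys_add[of u v] by (auto simp: aug_iff lookup_add sum.distrib)
  have aug_scale: "c *\<^sub>R u \<in> aug R" if "u \<in> aug R" for u c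
    using that finite_R by (auto simp: aug_iff in_keys_iff simp flip: sum_distrib_left)
  obtain x where x: "x \<in> sos_cone T" and eq: "Phi G x = \<Delta>2 + \<epsilon> *\<^sub>R \<Delta>" using assms(2) by blast
  obtain n :: nat and w where xw: "x = (\<Sum>i<n. tensor (w i) (w i))" and w: "\<And>i. i < n \<Longrightarrow> w i \<in> aug T"
    using x by (auto simp: sos_cone_def)
  have zero: "0 \<in> aug R" by (simp add: aug_def)
  have "(\<Sum>i<j. Phi G (tensor (w i) (w i))) \<in> aug R \<and> 0 \<le> x' (\<Sum>i<j. Phi G (tensor (w i) (w i)))"
    if "j \<le> n" for j
    using that
  proof (induction j)
    case 0
    then show ?case using zero lin(2)[OF zero zero, of 0] by simp
  next
    case (Suc j)
    have "w j \<in> aug T" using w Suc.prems by simp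
    then have "Phi G (tensor (w j) (w j)) \<in> aug R" "0 \<le> x' (Phi G (tensor (w j) (w j)))"
      using x' Phi_tensor_aug by (auto simp: dual_feasible_def)
    then show ?case using Suc by (simp add: aug_add lin)
  qed
  then have "0 \<le> x' (Phi G x)" by (simp add: xw linear_sum[OF linear_Phi])
  moreover have "x' (\<Delta>2 + \<epsilon> *\<^sub>R \<Delta>) = x' \<Delta>2 + \<epsilon>"
    using x' Phi_tensor_aug[OF laplacian_aug laplacian_aug] laplacian_aug_R
    by (simp add: lin aug_scale laplacian_squared dual_feasible_def)
  ultimately show ?thesis using eq by simp
qed

end

theorem lemma3p3:
  fixes \<Gamma> :: "('a, 'b) monoid_scheme" and S T :: "'a set"
  assumes "group \<Gamma>"
    and "finite S" and "S \<subseteq> carrier \<Gamma>" and "set_inv\<^bsub>\<Gamma>\<^esub> S = S"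
    and "generate \<Gamma> S = carrier \<Gamma>"
    and "T \<in> connected_supports \<Gamma> S"
  shows "let \<Delta> = laplacian \<Gamma> S;
             \<Delta>2 = gr_mult \<Gamma> \<Delta> \<Delta>;
             E = {\<epsilon> :: real. \<exists>x\<in>sos_cone T. Phi \<Gamma> x = \<Delta>2 + \<epsilon> *\<^sub>R \<Delta>};
             F = dual_feasible \<Gamma> S T
         in (INF \<epsilon>\<in>E. ereal \<epsilon>) = - (INF x'\<in>F. ereal (x' \<Delta>2)) \<and>
            (carrier \<Gamma> \<noteq> {\<one>\<^bsub>\<Gamma>\<^esub>} \<longrightarrow>
               (\<exists>\<epsilon>\<in>E. ereal \<epsilon> = (INF \<epsilon>\<in>E. ereal \<epsilon>)) \<and>
               (\<exists>x'\<in>F. ereal (x' \<Delta>2) = (INF x'\<in>F. ereal (x' \<Delta>2))))"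
proof -
  interpret cayley_support \<Gamma> S T
    using assms by (simp add: cayley_support_def cayley_support_axioms_def)
  let ?F = "dual_feasible \<Gamma> S T"
  show ?thesis
  proof (cases "carrier \<Gamma> = {\<one>\<^bsub>\<Gamma>\<^esub>}")
    case True
    have "\<Delta> = 0"
    proof (rule poly_mapping_eqI)
      fix k
      have "S \<subseteq> {\<one>\<^bsub>\<Gamma>\<^esub>}" using True S_carrier by simp
      then show "Poly_Mapping.lookup \<Delta> k = Poly_Mapping.lookup 0 k"
        by (auto simp: lookup_laplacian subset_singleton_iff)
    qed
    then have z: "\<Delta> = 0" "gr_mult \<Gamma> 0 0 = 0" by (simp_all add: gr_mult_def)
    have "x' 0 = 0" if "linear_functional_on (aug R) x'" for x' :: "('a \<Rightarrow>\<^sub>0 real) \<Rightarrow> real"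
    proof -
      have "0 \<in> aug R" by (simp add: aug_def)
      then have "x' (0 *\<^sub>R 0) = 0 * x' 0" using that unfolding linear_functional_on_def by blast
      then show ?thesis by simp
    qed
    then have "?F = {}" unfolding dual_feasible_def z by force
    moreover have "E = UNIV"
      using sos_cone_zero[of T] by (auto simp: z linear_0[OF linear_Phi] intro!: bexI[of _ 0])
    moreover have "(INF \<epsilon>. ereal \<epsilon>) = - \<infinity>"
    proof (rule ereal_bot)
      show "(INF \<epsilon>. ereal \<epsilon>) \<le> ereal B" for B by (rule INF_lower) simp
    qed
    ultimately show ?thesis unfolding Let_def using True by (simp add: top_ereal_def)
  next
    case False
    obtain \<epsilon>0 where e0: "\<epsilon>0 \<in> E" "\<forall>\<epsilon>\<in>E. \<epsilon>0 \<le> \<epsilon>" using E_attained[OF False] by blast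
    then have "Inf E = \<epsilon>0" by (intro cInf_eq_minimum) auto
    then obtain x0 where x0: "x0 \<in> ?F" "x0 \<Delta>2 = - \<epsilon>0" using dual_attained(2)[OF False] by auto
    have E: "(INF \<epsilon>\<in>E. ereal \<epsilon>) = ereal \<epsilon>0"
      using e0 by (intro antisym INF_lower INF_greatest) auto
    have F: "(INF x'\<in>?F. ereal (x' \<Delta>2)) = ereal (- \<epsilon>0)"
    proof (rule antisym)
      show "(INF x'\<in>?F. ereal (x' \<Delta>2)) \<le> ereal (- \<epsilon>0)" using INF_lower[OF x0(1)] x0(2) by metis
      show "ereal (- \<epsilon>0) \<le> (INF x'\<in>?F. ereal (x' \<Delta>2))"
        using weak_duality e0(1) by (intro INF_greatest) auto
    qed
    show ?thesis unfolding Let_def E F using e0(1) x0 by auto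
  qed
qed

end
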